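(* There is no absolute constant $c>0$ such that for all open sets $V\subset\mathbb{R}^2$ of finite measure $$\|\mathcal{P}^1_+\mathcal{P}^2_+\chi_V\|_{L^2(\mathbb{R}^2)}\ \geq\ c\,\|\chi_V\|_{L^2(\mathbb{R}^2)} .$$
   Context: $\chi_V$ is the indicator function of $V$. $\mathcal{P}^1_+$ and $\mathcal{P}^2_+$ are the Fourier projections on $L^2(\mathbb{R}^2)$ given by multiplication of the Fourier transform $\hat f(\xi_1,\xi_2)$ by the indicator function of the half-plane $\{\xi_1>0\}$, respectively $\{\xi_2>0\}$. *)

theory Defs
  imports "HOL-Analysis.Analysis"
begin

text \<open>
  Elements of \<open>L\<^sup>2\<close> are represented by Borel functions, with no quotient by equality almost
  everywhere. The real integral defining \<open>L2_norm\<close> is \<open>0\<close> off \<open>L2_space\<close>, so \<open>L2_norm f\<close> is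
  meaningful only for \<open>f \<in> L2_space\<close>.
\<close>

definition L2_space :: "('a::euclidean_space \<Rightarrow> complex) set" where
  "L2_space = {f \<in> borel_measurable lborel. integrable lborel (\<lambda>x. (cmod (f x))\<^sup>2)}"

definition L2_norm :: "('a::euclidean_space \<Rightarrow> complex) \<Rightarrow> real" where
  "L2_norm f = sqrt (LINT x|lborel. (cmod (f x))\<^sup>2)"

definition L2_tendsto ::
  "(nat \<Rightarrow> 'a::euclidean_space \<Rightarrow> complex) \<Rightarrow> ('a \<Rightarrow> complex) \<Rightarrow> bool" where
  "L2_tendsto \<phi> f \<longleftrightarrow>
     (\<forall>n. \<phi> n \<in> L2_space) \<and> f \<in> L2_space \<and> (\<lambda>n. L2_norm (\<lambda>x. \<phi> n x - f x)) \<longlonglongrightarrow> 0"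

text \<open>The normalisation with \<open>2\<pi>\<close> in the exponent makes the Fourier transform unitary on \<open>L\<^sup>2\<close>.\<close>

definition fourier_integral :: "('a::euclidean_space \<Rightarrow> complex) \<Rightarrow> 'a \<Rightarrow> complex" where
  "fourier_integral f \<xi> = (LINT x|lborel. cis (- 2 * pi * (x \<bullet> \<xi>)) * f x)"

text \<open>
  The Fourier transform on \<open>L\<^sup>2\<close> is the continuous extension of \<open>fourier_integral\<close> from the dense
  subspace \<open>L\<^sup>1 \<inter> L\<^sup>2\<close>. It is given as a relation because \<open>F\<close> is only determined almost everywhere.
\<close>

definition has_L2_fourier ::
  "('a::euclidean_space \<Rightarrow> complex) \<Rightarrow> ('a \<Rightarrow> complex) \<Rightarrow> bool" where
  "has_L2_fourier f F \<longleftrightarrow>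
     (\<exists>\<phi>. (\<forall>n. integrable lborel (\<phi> n)) \<and> L2_tendsto \<phi> f \<and>
          L2_tendsto (\<lambda>n. fourier_integral (\<phi> n)) F)"

text \<open>
  For \<open>f \<in> L2_space\<close> and Borel \<open>S\<close> a function \<open>g\<close> as below exists by Plancherel's theorem and is
  unique almost everywhere; the choice operator merely selects a representative.
\<close>

definition fourier_projection ::
  "'a::euclidean_space set \<Rightarrow> ('a \<Rightarrow> complex) \<Rightarrow> 'a \<Rightarrow> complex" where
  "fourier_projection S f =
     (SOME g. \<exists>F. has_L2_fourier f F \<and> has_L2_fourier g (\<lambda>\<xi>. indicator S \<xi> * F \<xi>))"

definition P1_plus :: "(real \<times> real \<Rightarrow> complex) \<Rightarrow> real \<times> real \<Rightarrow> complex" where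
  "P1_plus = fourier_projection {\<xi>. fst \<xi> > 0}"

definition P2_plus :: "(real \<times> real \<Rightarrow> complex) \<Rightarrow> real \<times> real \<Rightarrow> complex" where
  "P2_plus = fourier_projection {\<xi>. snd \<xi> > 0}"

end

theory Submission
  imports Defs "HOL-Probability.Characteristic_Functions" "HOL-Real_Asymp.Real_Asymp"
begin

text \<open>
  The counterexamples are thin strips along the diagonal, \<open>V = {0 < x < 1, \<bar>y - x\<bar> < w}\<close> with
  \<open>w \<rightarrow> 0\<close>. The Fourier transform of \<open>\<chi>\<^sub>V\<close> at \<open>(\<xi>, \<eta>)\<close> factors as \<open>D (\<xi> + \<eta>) S (\<eta>)\<close>, where \<open>D\<close>
  and \<open>S\<close> are the transforms of the indicators of \<open>(0, 1)\<close> and \<open>(-w, w)\<close>. It is concentrated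
  along the antidiagonal, which misses the quadrant \<open>\<xi>, \<eta> > 0\<close>: there
  \<open>\<bar>D (\<xi> + \<eta>)\<bar>\<^sup>2 \<bar>S (\<eta>)\<bar>\<^sup>2 / \<bar>V\<bar> \<le> min (1, 1 / (\<xi> + \<eta>)\<^sup>2) \<cdot> min (2 w, 1 / \<eta>)\<close>, whose integral over the
  quadrant tends to \<open>0\<close> by dominated convergence.

  That the projections are given by multiplication on the Fourier side is the Plancherel theorem
  together with the surjectivity of the Fourier transform on \<open>L\<^sup>2\<close>. Norm preservation comes from
  testing \<open>\<bar>F f\<bar>\<^sup>2\<close>, the Fourier transform of the autocorrelation of \<open>f\<close>, against widening Gaussians
  and from the continuity of translations in \<open>L\<^sup>2\<close>.
\<close>

subsection \<open>The space \<open>L\<^sup>2\<close>\<close>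

lemma L2_spaceI:
  assumes "f \<in> borel_measurable borel" "integrable lborel (\<lambda>x. (cmod (f x))\<^sup>2)"
  shows "f \<in> L2_space"
  using assms by (simp add: L2_space_def)

lemma L2_space_measurable [measurable_dest]: "f \<in> L2_space \<Longrightarrow> f \<in> borel_measurable borel"
  by (simp add: L2_space_def)

lemma L2_space_integrable: "f \<in> L2_space \<Longrightarrow> integrable lborel (\<lambda>x. (cmod (f x))\<^sup>2)"
  by (simp add: L2_space_def)

lemma L2_norm_nonneg [simp]: "L2_norm f \<ge> 0"
  by (simp add: L2_norm_def)

lemma L2_norm_power2: "(L2_norm f)\<^sup>2 = (LINT x|lborel. (cmod (f x))\<^sup>2)"
  by (simp add: L2_norm_def)

lemma L2_norm_minus_commute: "L2_norm (\<lambda>x. f x - g x) = L2_norm (\<lambda>x. g x - f x)"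
  by (simp add: L2_norm_def norm_minus_commute)

lemma L2_norm_cong_AE:
  assumes "f \<in> L2_space" "g \<in> L2_space" "AE x in lborel. f x = g x"
  shows "L2_norm f = L2_norm g"
proof -
  have [measurable]: "f \<in> borel_measurable borel" "g \<in> borel_measurable borel"
    using assms by (auto dest: L2_space_measurable)
  show ?thesis
    unfolding L2_norm_def
    by (intro arg_cong[where f=sqrt] integral_cong_AE) (use assms(3) in auto)
qed

lemma L2_spaceI_bounded:
  assumes [measurable]: "f \<in> borel_measurable borel" and "integrable lborel g"
    and "\<And>x. (cmod (f x))\<^sup>2 \<le> g x"
  shows "f \<in> L2_space"
proof (rule L2_spaceI)
  show "integrable lborel (\<lambda>x. (cmod (f x))\<^sup>2)"
    using assms(2) by (rule Bochner_Integration.integrable_bound) (use assms(3) in \<open>auto intro: order_trans[OF _ abs_ge_self]\<close>)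
qed fact

lemma cmod_add_power2_le: "(cmod (a + b))\<^sup>2 \<le> 2 * (cmod a)\<^sup>2 + 2 * (cmod b)\<^sup>2"
proof -
  have "(cmod (a + b))\<^sup>2 \<le> (cmod a + cmod b)\<^sup>2"
    by (intro power_mono norm_triangle_ineq) auto
  also have "\<dots> \<le> 2 * (cmod a)\<^sup>2 + 2 * (cmod b)\<^sup>2"
    using sum_squares_bound[of "cmod a" "cmod b"] by (simp add: power2_sum)
  finally show ?thesis .
qed

lemma L2_space_add:
  assumes "f \<in> L2_space" "g \<in> L2_space"
  shows "(\<lambda>x. f x + g x) \<in> L2_space"
proof (rule L2_spaceI_bounded)
  show "integrable lborel (\<lambda>x. 2 * (cmod (f x))\<^sup>2 + 2 * (cmod (g x))\<^sup>2)"
    using assms by (intro Bochner_Integration.integrable_add integrable_mult_right L2_space_integrable)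
qed (use assms cmod_add_power2_le in \<open>auto dest: L2_space_measurable\<close>)

lemma L2_space_uminus: "f \<in> L2_space \<Longrightarrow> (\<lambda>x. - f x) \<in> L2_space"
  by (auto simp: L2_space_def)

lemma L2_space_diff:
  assumes "f \<in> L2_space" "g \<in> L2_space"
  shows "(\<lambda>x. f x - g x) \<in> L2_space"
  using L2_space_add[OF assms(1) L2_space_uminus[OF assms(2)]] by simp

lemma L2_space_indicator_mult:
  fixes f :: "'a::euclidean_space \<Rightarrow> complex"
  assumes "f \<in> L2_space" "S \<in> sets borel"
  shows "(\<lambda>x. indicator S x * f x) \<in> L2_space"
proof (rule L2_spaceI_bounded)
  show "integrable lborel (\<lambda>x. (cmod (f x))\<^sup>2)"
    using assms by (auto dest: L2_space_integrable)
  show "(\<lambda>x. indicator S x * f x) \<in> borel_measurable borel"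
    using assms by (auto dest: L2_space_measurable)
qed (auto simp: indicator_def)

lemma L2_integrable_mult_norm:
  assumes "f \<in> L2_space" "g \<in> L2_space"
  shows "integrable lborel (\<lambda>x. cmod (f x) * cmod (g x))"
proof -
  have [measurable]: "f \<in> borel_measurable borel" "g \<in> borel_measurable borel"
    using assms by (auto dest: L2_space_measurable)
  have "integrable lborel (\<lambda>x. (cmod (f x))\<^sup>2 + (cmod (g x))\<^sup>2)"
    using assms by (intro Bochner_Integration.integrable_add L2_space_integrable)
  then show ?thesis
  proof (rule Bochner_Integration.integrable_bound)
    have "cmod a * cmod b \<le> (cmod a)\<^sup>2 + (cmod b)\<^sup>2" for a b
      using sum_squares_bound[of "cmod a" "cmod b"] mult_nonneg_nonneg[of "cmod a" "cmod b"]
      by (simp del: mult_nonneg_nonneg zero_le_mult_iff)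
    then show "AE x in lborel. norm (cmod (f x) * cmod (g x)) \<le> norm ((cmod (f x))\<^sup>2 + (cmod (g x))\<^sup>2)"
      by simp
  qed simp
qed

text \<open>Carried over from the inequality for nonnegative extended integrals: membership in
  \<open>L2_space\<close> makes all three integrals finite, so they agree with the real
  ones.\<close>

lemma L2_Cauchy_Schwarz:
  assumes "f \<in> L2_space" "g \<in> L2_space"
  shows "(LINT x|lborel. cmod (f x) * cmod (g x)) \<le> L2_norm f * L2_norm g"
proof -
  have [measurable]: "f \<in> borel_measurable borel" "g \<in> borel_measurable borel"
    using assms by (auto dest: L2_space_measurable)
  let ?I = "LINT x|lborel. cmod (f x) * cmod (g x)"
  have "(\<integral>\<^sup>+x. ennreal (cmod (f x)) * ennreal (cmod (g x)) \<partial>lborel)\<^sup>2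
      \<le> (\<integral>\<^sup>+x. (ennreal (cmod (f x)))\<^sup>2 \<partial>lborel) * (\<integral>\<^sup>+x. (ennreal (cmod (g x)))\<^sup>2 \<partial>lborel)"
    by (rule Cauchy_Schwarz_nn_integral) simp_all
  moreover have "(\<integral>\<^sup>+x. ennreal (cmod (f x)) * ennreal (cmod (g x)) \<partial>lborel) = ennreal ?I"
    using L2_integrable_mult_norm[OF assms]
    by (subst nn_integral_eq_integral[symmetric]) (auto simp: ennreal_mult)
  moreover have "(\<integral>\<^sup>+x. (ennreal (cmod (h x)))\<^sup>2 \<partial>lborel) = ennreal ((L2_norm h)\<^sup>2)"
    if "h \<in> L2_space" for h :: "'a \<Rightarrow> complex"
    using L2_space_integrable[OF that]
    by (simp add: L2_norm_power2 ennreal_power nn_integral_eq_integral[symmetric])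
  ultimately have "ennreal (?I\<^sup>2) \<le> ennreal ((L2_norm f)\<^sup>2 * (L2_norm g)\<^sup>2)"
    using assms by (simp add: ennreal_power ennreal_mult)
  then have "?I\<^sup>2 \<le> (L2_norm f * L2_norm g)\<^sup>2"
    by (simp add: power_mult_distrib ennreal_le_iff)
  then show ?thesis
    by (rule power2_le_imp_le) simp
qed

lemma L2_norm_triangle:
  assumes "f \<in> L2_space" "g \<in> L2_space"
  shows "L2_norm (\<lambda>x. f x + g x) \<le> L2_norm f + L2_norm g"
proof (rule power2_le_imp_le)
  have "(L2_norm (\<lambda>x. f x + g x))\<^sup>2
      \<le> (LINT x|lborel. (cmod (f x))\<^sup>2 + (cmod (g x))\<^sup>2 + 2 * (cmod (f x) * cmod (g x)))"
    unfolding L2_norm_power2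
  proof (rule integral_mono)
    show "integrable lborel (\<lambda>x. (cmod (f x + g x))\<^sup>2)"
      using L2_space_add[OF assms] by (rule L2_space_integrable)
    show "integrable lborel (\<lambda>x. (cmod (f x))\<^sup>2 + (cmod (g x))\<^sup>2 + 2 * (cmod (f x) * cmod (g x)))"
      using assms by (intro Bochner_Integration.integrable_add integrable_mult_right L2_space_integrable
        L2_integrable_mult_norm)
    show "(cmod (f x + g x))\<^sup>2 \<le> (cmod (f x))\<^sup>2 + (cmod (g x))\<^sup>2 + 2 * (cmod (f x) * cmod (g x))" for x
      using power_mono[OF norm_triangle_ineq[of "f x" "g x"], of 2] by (simp add: power2_sum)
  qed
  also have "\<dots> = (L2_norm f)\<^sup>2 + (L2_norm g)\<^sup>2 + 2 * (LINT x|lborel. cmod (f x) * cmod (g x))"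
    using assms L2_integrable_mult_norm[OF assms]
    by (simp add: L2_norm_power2 L2_space_integrable)
  also have "\<dots> \<le> (L2_norm f + L2_norm g)\<^sup>2"
    using L2_Cauchy_Schwarz[OF assms] by (simp add: power2_sum)
  finally show "(L2_norm (\<lambda>x. f x + g x))\<^sup>2 \<le> (L2_norm f + L2_norm g)\<^sup>2" .
qed simp

lemma L2_dist_triangle:
  assumes "f \<in> L2_space" "g \<in> L2_space" "h \<in> L2_space"
  shows "L2_norm (\<lambda>x. f x - h x) \<le> L2_norm (\<lambda>x. f x - g x) + L2_norm (\<lambda>x. g x - h x)"
  using L2_norm_triangle[OF L2_space_diff[OF assms(1,2)] L2_space_diff[OF assms(2,3)]] by simp

lemma L2_norm_triangle_diff:
  assumes "f \<in> L2_space" "g \<in> L2_space"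
  shows "\<bar>L2_norm f - L2_norm g\<bar> \<le> L2_norm (\<lambda>x. f x - g x)"
  using L2_norm_triangle[OF L2_space_diff[OF assms] assms(2)]
    L2_norm_triangle[OF L2_space_diff[OF assms(2,1)] assms(1)]
  by (simp add: L2_norm_minus_commute[of g f] abs_le_iff)

lemma L2_norm_eq_0_imp_AE:
  assumes "f \<in> L2_space" "L2_norm f = 0"
  shows "AE x in lborel. f x = 0"
  using assms integral_nonneg_eq_0_iff_AE[OF L2_space_integrable[OF assms(1)]]
  by (simp add: L2_norm_def)

lemma L2_tendsto_imp_norm:
  assumes "L2_tendsto \<phi> f"
  shows "(\<lambda>n. L2_norm (\<phi> n)) \<longlonglongrightarrow> L2_norm f"
proof -
  have "(\<lambda>n. L2_norm (\<lambda>x. \<phi> n x - f x)) \<longlonglongrightarrow> 0" "f \<in> L2_space" "\<And>n. \<phi> n \<in> L2_space"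
    using assms by (auto simp: L2_tendsto_def)
  then have "(\<lambda>n. L2_norm (\<phi> n) - L2_norm f) \<longlonglongrightarrow> 0"
    by (intro Lim_null_comparison[of "\<lambda>n. L2_norm (\<phi> n) - L2_norm f"] always_eventually)
      (auto intro: L2_norm_triangle_diff)
  then show ?thesis
    by (simp add: LIM_zero_iff)
qed

text \<open>Going from \<open>f\<close> to \<open>g\<close> through \<open>\<phi> n\<close> and
  \<open>\<psi> n\<close> costs three distances, each tending to 0. The case of two different
  approximating sequences is the one that uniqueness of the Fourier transform calls for.\<close>

lemma L2_tendsto_unique_AE:
  assumes "L2_tendsto \<phi> f" "L2_tendsto \<psi> g"
    and "(\<lambda>n. L2_norm (\<lambda>x. \<phi> n x - \<psi> n x)) \<longlonglongrightarrow> 0"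
  shows "AE x in lborel. f x = g x"
proof -
  have *: "f \<in> L2_space" "g \<in> L2_space" "\<And>n. \<phi> n \<in> L2_space" "\<And>n. \<psi> n \<in> L2_space"
    "(\<lambda>n. L2_norm (\<lambda>x. \<phi> n x - f x)) \<longlonglongrightarrow> 0" "(\<lambda>n. L2_norm (\<lambda>x. \<psi> n x - g x)) \<longlonglongrightarrow> 0"
    using assms by (auto simp: L2_tendsto_def)
  have "L2_norm (\<lambda>x. f x - g x) \<le> 0"
  proof (rule tendsto_lowerbound)
    show "(\<lambda>n. L2_norm (\<lambda>x. \<phi> n x - f x) + (L2_norm (\<lambda>x. \<phi> n x - \<psi> n x) + L2_norm (\<lambda>x. \<psi> n x - g x))) \<longlonglongrightarrow> 0"
      using *(5,6) assms(3) by (auto intro!: tendsto_eq_intros)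
    show "\<forall>\<^sub>F n in sequentially. L2_norm (\<lambda>x. f x - g x)
       \<le> L2_norm (\<lambda>x. \<phi> n x - f x) + (L2_norm (\<lambda>x. \<phi> n x - \<psi> n x) + L2_norm (\<lambda>x. \<psi> n x - g x))"
    proof (intro always_eventually allI)
      fix n
      show "L2_norm (\<lambda>x. f x - g x)
       \<le> L2_norm (\<lambda>x. \<phi> n x - f x) + (L2_norm (\<lambda>x. \<phi> n x - \<psi> n x) + L2_norm (\<lambda>x. \<psi> n x - g x))"
        using L2_dist_triangle[OF *(1) *(3)[of n] *(2)] L2_dist_triangle[OF *(3)[of n] *(4)[of n] *(2)]
          L2_norm_minus_commute[of f "\<phi> n"] by simp
    qed
  qed simp
  then have "AE x in lborel. f x - g x = 0"
    using L2_norm_eq_0_imp_AE[OF L2_space_diff[OF *(1,2)]] by (simp add: order_antisym)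
  then show ?thesis by simp
qed

section \<open>Nonnegative integrals of squares and completeness\<close>

lemma nn_integral_cmod_power2:
  assumes "f \<in> L2_space"
  shows "(\<integral>\<^sup>+x. ennreal ((cmod (f x))\<^sup>2) \<partial>lborel) = ennreal ((L2_norm f)\<^sup>2)"
  by (simp add: L2_norm_power2 nn_integral_eq_integral L2_space_integrable[OF assms])

text \<open>A bound on \<open>L2_norm\<close> alone proves nothing about membership, since the real
  integral defaults to 0; a bound on the nonnegative integral gives membership and norm
  together.\<close>

lemma L2_nn_integralI:
  assumes [measurable]: "f \<in> borel_measurable borel" and "0 \<le> C"
    and le: "(\<integral>\<^sup>+x. ennreal ((cmod (f x))\<^sup>2) \<partial>lborel) \<le> ennreal (C\<^sup>2)"
  shows "f \<in> L2_space" "L2_norm f \<le> C"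
proof -
  show f: "f \<in> L2_space"
    by (intro L2_spaceI integrableI_bounded) (use le in \<open>auto simp: top_unique intro: le_less_trans\<close>)
  show "L2_norm f \<le> C"
    using le \<open>0 \<le> C\<close> unfolding nn_integral_cmod_power2[OF f]
    by (auto intro: power2_le_imp_le)
qed

text \<open>Riesz-Fischer for sequences with geometrically small steps: the steps decay
  geometrically at almost every point, which gives a pointwise limit, and Fatou's lemma turns it
  into an \<open>L\<^sup>2\<close> limit.\<close>

lemma L2_complete_fast:
  fixes \<phi> :: "nat \<Rightarrow> 'a::euclidean_space \<Rightarrow> complex"
  assumes L2: "\<And>n. \<phi> n \<in> L2_space"
    and fast: "\<And>n. L2_norm (\<lambda>x. \<phi> (Suc n) x - \<phi> n x) \<le> (1/2)^n"
  obtains g where "L2_tendsto \<phi> g"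
proof -
  have [measurable]: "\<phi> n \<in> borel_measurable borel" for n
    using L2 by (rule L2_space_measurable)
  define d where "d n x = (cmod (\<phi> (Suc n) x - \<phi> n x))\<^sup>2" for n x
  have [measurable]: "d n \<in> borel_measurable borel" for n
    unfolding d_def by measurable
  \<comment> \<open>The integral of \<open>d n\<close> is at most \<open>(1/4)^n\<close>, so a
    weight \<open>2^n\<close> can be afforded. Finiteness of the weighted sum at a point then forces
    decay of \<open>d n x\<close> like \<open>2^-n\<close>.\<close>
  have "(\<integral>\<^sup>+x. ennreal (2^n * d n x) \<partial>lborel) \<le> ennreal ((1/2)^n)" for n
  proof -
    have "(\<integral>\<^sup>+x. ennreal (2^n * d n x) \<partial>lborel) = ennreal (2^n) * (\<integral>\<^sup>+x. ennreal (d n x) \<partial>lborel)"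
      by (subst nn_integral_cmult[symmetric]) (auto simp: ennreal_mult d_def)
    also have "\<dots> \<le> ennreal (2^n) * ennreal (((1/2)^n)\<^sup>2)"
      unfolding d_def nn_integral_cmod_power2[OF L2_space_diff[OF L2 L2]]
      by (intro mult_left_mono ennreal_leI power_mono fast) auto
    also have "ennreal (2^n) * ennreal (((1/2)^n)\<^sup>2) = ennreal ((1/2)^n)"
      by (simp add: power2_eq_square field_simps flip: ennreal_mult)
    finally show ?thesis .
  qed
  then have "(\<integral>\<^sup>+x. (\<Sum>n. ennreal (2^n * d n x)) \<partial>lborel) \<le> (\<Sum>n. ennreal ((1/2)^n))"
    by (subst nn_integral_suminf) (auto intro!: suminf_le)
  also have "\<dots> < \<infinity>"
    by (subst suminf_ennreal2) (auto intro!: summable_geometric)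
  finally have "AE x in lborel. (\<Sum>n. ennreal (2^n * d n x)) \<noteq> \<infinity>"
    by (intro nn_integral_noteq_infinite) auto
  then have conv: "AE x in lborel. convergent (\<lambda>n. \<phi> n x)"
  proof eventually_elim
    fix x assume "(\<Sum>n. ennreal (2^n * d n x)) \<noteq> \<infinity>"
    then have "summable (\<lambda>n. 2^n * d n x)"
      by (intro summable_suminf_not_top) (auto simp: d_def)
    then have "Bseq (\<lambda>n. 2^n * d n x)"
      using summable_LIMSEQ_zero convergentI convergent_imp_Bseq by blast
    then obtain K where K: "K > 0" "\<And>n. norm (2^n * d n x) \<le> K"
      by (auto simp: Bseq_def)
    \<comment> \<open>The root of \<open>K / 2^n\<close> is still geometric, with ratio
      \<open>sqrt (1/2) < 1\<close>, so the steps are absolutely summable.\<close>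
    have "cmod (\<phi> (Suc n) x - \<phi> n x) \<le> sqrt K * (sqrt (1/2))^n" for n
    proof (rule power2_le_imp_le)
      have "d n x \<le> K / 2^n"
        using K(2)[of n] by (simp add: d_def field_simps)
      then show "(cmod (\<phi> (Suc n) x - \<phi> n x))\<^sup>2 \<le> (sqrt K * sqrt (1/2) ^ n)\<^sup>2"
        using K(1) by (simp add: d_def power_mult_distrib power_divide real_sqrt_divide flip: power_mult mult.commute[of 2]) (simp add: power_mult)
    qed (use K in auto)
    moreover have "summable (\<lambda>n. sqrt K * (sqrt (1/2))^n)"
      by (intro summable_mult summable_geometric) (auto simp: real_sqrt_divide)
    ultimately have "summable (\<lambda>n. \<phi> (Suc n) x - \<phi> n x)"
      by (metis (no_types, lifting) summable_comparison_test)
    then have "convergent (\<lambda>n. \<Sum>i<n. \<phi> (Suc i) x - \<phi> i x)"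
      by (simp add: summable_iff_convergent)
    then have "convergent (\<lambda>n. (\<Sum>i<n. \<phi> (Suc i) x - \<phi> i x) + \<phi> 0 x)"
      by (intro convergent_add convergent_const)
    then show "convergent (\<lambda>n. \<phi> n x)"
      by (simp add: sum_lessThan_telescope[of "\<lambda>i. \<phi> i x"])
  qed
  \<comment> \<open>Where the sequence diverges, \<open>lim\<close> returns some default value; this
    concerns a null set only, and \<open>g\<close> is Borel everywhere.\<close>
  define g where "g x = lim (\<lambda>n. \<phi> n x)" for x
  have [measurable]: "g \<in> borel_measurable borel"
    unfolding g_def by measurable
  \<comment> \<open>The right-hand side is the exact sum of the geometric steps from
    \<open>n\<close> to \<open>n + k - 1\<close>, so the induction closes; dropping the subtracted
    term gives a bound uniform in \<open>k\<close>.\<close>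
  have step: "L2_norm (\<lambda>x. \<phi> n x - \<phi> (n + k) x) \<le> 2 * (1/2)^n - 2 * (1/2)^(n+k)" for n k
  proof (induction k)
    case 0
    show ?case by (simp add: L2_norm_def)
  next
    case (Suc k)
    then show ?case
      using L2_dist_triangle[OF L2[of n] L2[of "n+k"] L2[of "n + Suc k"]] fast[of "n+k"]
        L2_norm_minus_commute[of "\<phi> (n+k)" "\<phi> (Suc (n+k))"]
      by simp
  qed
  have bound: "(\<integral>\<^sup>+x. ennreal ((cmod (\<phi> n x - g x))\<^sup>2) \<partial>lborel) \<le> ennreal ((2 * (1/2)^n)\<^sup>2)" for n
  proof -
    have "(\<integral>\<^sup>+x. ennreal ((cmod (\<phi> n x - g x))\<^sup>2) \<partial>lborel)
       = (\<integral>\<^sup>+x. liminf (\<lambda>k. ennreal ((cmod (\<phi> n x - \<phi> (n + k) x))\<^sup>2)) \<partial>lborel)"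
    proof (intro nn_integral_cong_AE, use conv in eventually_elim)
      fix x assume "convergent (\<lambda>n. \<phi> n x)"
      then have "(\<lambda>k. \<phi> (k + n) x) \<longlonglongrightarrow> g x"
        by (intro LIMSEQ_ignore_initial_segment) (simp add: g_def convergent_LIMSEQ_iff)
      then have "(\<lambda>k. ennreal ((cmod (\<phi> n x - \<phi> (n + k) x))\<^sup>2)) \<longlonglongrightarrow> ennreal ((cmod (\<phi> n x - g x))\<^sup>2)"
        by (intro tendsto_intros) (simp add: add.commute)
      then show "ennreal ((cmod (\<phi> n x - g x))\<^sup>2) = liminf (\<lambda>k. ennreal ((cmod (\<phi> n x - \<phi> (n + k) x))\<^sup>2))"
        by (rule lim_imp_Liminf[OF sequentially_bot, symmetric])
    qed
    \<comment> \<open>Fatou's lemma.\<close>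
    also have "\<dots> \<le> liminf (\<lambda>k. \<integral>\<^sup>+x. ennreal ((cmod (\<phi> n x - \<phi> (n + k) x))\<^sup>2) \<partial>lborel)"
      by (rule nn_integral_liminf) simp
    also have "\<dots> \<le> liminf (\<lambda>k::nat. ennreal ((2 * (1/2)^n)\<^sup>2))"
    proof (intro Liminf_mono always_eventually allI)
      fix k
      show "(\<integral>\<^sup>+x. ennreal ((cmod (\<phi> n x - \<phi> (n + k) x))\<^sup>2) \<partial>lborel) \<le> ennreal ((2 * (1/2)^n)\<^sup>2)"
        unfolding nn_integral_cmod_power2[OF L2_space_diff[OF L2 L2]]
        using step[of n k] by (intro ennreal_leI power_mono) (auto intro: order_trans)
    qed
    finally show ?thesis by (simp add: Liminf_const)
  qed
  have g: "(\<lambda>x. \<phi> n x - g x) \<in> L2_space" "L2_norm (\<lambda>x. \<phi> n x - g x) \<le> 2 * (1/2)^n" for n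
    using L2_nn_integralI[OF _ _ bound[of n]] by auto
  have "L2_tendsto \<phi> g"
    unfolding L2_tendsto_def
  proof (intro conjI allI L2)
    show "g \<in> L2_space"
      using L2_space_diff[OF L2[of 0] g(1)[of 0]] by simp
    have "(\<lambda>n. 2 * (1/2::real)^n) \<longlonglongrightarrow> 0"
      by (intro tendsto_mult_right_zero LIMSEQ_power_zero) simp
    then show "(\<lambda>n. L2_norm (\<lambda>x. \<phi> n x - g x)) \<longlonglongrightarrow> 0"
      by (rule Lim_null_comparison[rotated]) (use g(2) in auto)
  qed
  then show thesis by (rule that)
qed

section \<open>Indicators of sets of finite measure\<close>

lemma integrable_indicator_lborel:
  fixes A :: "'a::euclidean_space set"
  assumes "A \<in> sets borel" "emeasure lborel A < \<infinity>"
  shows "integrable lborel (indicator A :: 'a \<Rightarrow> complex)"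
proof -
  have "integrable lborel (\<lambda>x. indicator A x *\<^sub>R (1::complex))"
    using assms by (intro integrable_scaleR_left) simp
  then show ?thesis
    by (simp add: scaleR_conv_of_real of_real_indicator)
qed

lemma L2_space_indicator:
  fixes A :: "'a::euclidean_space set"
  assumes [measurable]: "A \<in> sets borel" and "emeasure lborel A < \<infinity>"
  shows "(indicator A :: 'a \<Rightarrow> complex) \<in> L2_space"
proof (rule L2_spaceI_bounded)
  show "integrable lborel (indicator A :: 'a \<Rightarrow> real)"
    using assms by simp
  show "(indicator A :: 'a \<Rightarrow> complex) \<in> borel_measurable borel"
    by (rule borel_measurable_indicator) simp
qed (auto simp: indicator_def)

lemma L2_norm_indicator_power2:
  fixes A :: "'a::euclidean_space set"
  shows "(L2_norm (indicator A :: 'a \<Rightarrow> complex))\<^sup>2 = measure lborel A"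
proof -
  have "(cmod (indicator A x))\<^sup>2 = indicator A x" for x
    by (auto simp: indicator_def)
  then show ?thesis
    by (simp add: L2_norm_power2)
qed

subsection \<open>Continuity of translations\<close>

lemma integrable_lborel_translate:
  fixes f :: "'a::euclidean_space \<Rightarrow> 'b::{banach, second_countable_topology}"
  assumes "integrable lborel f"
  shows "integrable lborel (\<lambda>x. f (h + x))"
proof -
  have "integrable (distr lborel borel ((+) h)) f"
    using assms by (simp add: lborel_distr_plus)
  then show ?thesis
    by (subst (asm) integrable_distr_eq) (use assms in auto)
qed

lemma integral_lborel_translate:
  fixes f :: "'a::euclidean_space \<Rightarrow> 'b::{banach, second_countable_topology}"
  assumes [measurable]: "f \<in> borel_measurable borel"
  shows "(LINT x|lborel. f (h + x)) = (LINT x|lborel. f x)"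
proof -
  have "(LINT x|lborel. f x) = (LINT x|distr lborel borel ((+) h). f x)"
    by (simp add: lborel_distr_plus)
  also have "\<dots> = (LINT x|lborel. f (h + x))"
    by (rule integral_distr) auto
  finally show ?thesis by simp
qed

text \<open>By translation invariance the error of replacing \<open>f\<close> by \<open>g\<close> is
  the same before and after the shift. The budget is \<open>e/4\<close> for each of these two errors
  and \<open>e/2\<close> for the shift of \<open>g\<close>.\<close>

lemma tendsto_translate_L1_approx:
  fixes f :: "'a::euclidean_space \<Rightarrow> 'b::{banach, second_countable_topology}"
  assumes f: "integrable lborel f"
    and approx: "\<And>e. e > 0 \<Longrightarrow> \<exists>g. integrable lborel g \<and> (LINT x|lborel. norm (f x - g x)) < e \<and>
      (\<lambda>n. LINT x|lborel. norm (g (h n + x) - g x)) \<longlonglongrightarrow> 0"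
  shows "(\<lambda>n. LINT x|lborel. norm (f (h n + x) - f x)) \<longlonglongrightarrow> 0"
proof (rule LIMSEQ_I)
  fix e :: real assume "e > 0"
  then obtain g where g: "integrable lborel g" "(LINT x|lborel. norm (f x - g x)) < e/4"
      "(\<lambda>n. LINT x|lborel. norm (g (h n + x) - g x)) \<longlonglongrightarrow> 0"
    using approx[of "e/4"] by auto
  from LIMSEQ_D[OF g(3), of "e/2"] \<open>e > 0\<close>
  obtain N where N: "\<And>n. n \<ge> N \<Longrightarrow> \<bar>LINT x|lborel. norm (g (h n + x) - g x)\<bar> < e/2"
    by (auto simp: real_norm_def)
  note [measurable] = borel_measurable_integrable[OF f] borel_measurable_integrable[OF g(1)]
  have "(LINT x|lborel. norm (f (h n + x) - f x)) < e" if "n \<ge> N" for n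
  proof -
    note int = f g(1) integrable_lborel_translate[OF f, of "h n"] integrable_lborel_translate[OF g(1), of "h n"]
    have "(LINT x|lborel. norm (f (h n + x) - f x))
        \<le> (LINT x|lborel. norm (g (h n + x) - g x) + (norm (f (h n + x) - g (h n + x)) + norm (f x - g x)))"
    proof (rule integral_mono)
      fix x
      have eq: "f (h n + x) - f x = (g (h n + x) - g x) + ((f (h n + x) - g (h n + x)) - (f x - g x))"
        by simp
      show "norm (f (h n + x) - f x)
          \<le> norm (g (h n + x) - g x) + (norm (f (h n + x) - g (h n + x)) + norm (f x - g x))"
        unfolding eq by (intro order_trans[OF norm_triangle_ineq] add_left_mono norm_triangle_ineq4)
    qed (use int in auto)
    also have "\<dots> = (LINT x|lborel. norm (g (h n + x) - g x))
        + ((LINT x|lborel. norm (f (h n + x) - g (h n + x))) + (LINT x|lborel. norm (f x - g x)))"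
      using int by simp
    also have "(LINT x|lborel. norm (f (h n + x) - g (h n + x))) = (LINT x|lborel. norm (f x - g x))"
      by (rule integral_lborel_translate) simp
    finally show ?thesis
      using g(2) N[OF that] by simp
  qed
  then show "\<exists>N. \<forall>n\<ge>N. norm ((LINT x|lborel. norm (f (h n + x) - f x)) - 0) < e"
    by auto
qed

text \<open>Openness controls the shifted indicator only at points of \<open>U\<close>. The identity
  \<open>\<bar>s - t\<bar> = s + t - 2 * s * t\<close> for \<open>s, t\<close> in
  \<open>{0, 1}\<close> reduces everything to the overlap of \<open>U\<close> with its translate,
  whose integrand lives on \<open>U\<close>, and to the total mass, which a shift preserves.\<close>

lemma tendsto_translate_L1_open:
  fixes h :: "nat \<Rightarrow> 'a::euclidean_space" and c :: "'b::{banach, second_countable_topology}"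
  assumes U: "open U" "emeasure lborel U < \<infinity>" and h: "h \<longlonglongrightarrow> 0"
  shows "(\<lambda>n. LINT x|lborel. norm (indicator U (h n + x) *\<^sub>R c - indicator U x *\<^sub>R c)) \<longlonglongrightarrow> 0"
proof -
  let ?i = "indicator U :: 'a \<Rightarrow> real"
  have [measurable]: "U \<in> sets borel" using U by simp
  have int: "integrable lborel ?i" using U(2) by simp
  note int' = integrable_lborel_translate[OF int]
  have prod: "integrable lborel (\<lambda>x. ?i x * ?i (h n + x))" for n
    by (rule Bochner_Integration.integrable_bound[OF int]) (auto simp: indicator_def)
  have lim: "(\<lambda>n. LINT x|lborel. ?i x * ?i (h n + x)) \<longlonglongrightarrow> (LINT x|lborel. ?i x)"
  proof (rule integral_dominated_convergence[where w="?i"])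
    show "AE x in lborel. (\<lambda>n. ?i x * ?i (h n + x)) \<longlonglongrightarrow> ?i x"
    proof (intro AE_I2)
      fix x
      show "(\<lambda>n. ?i x * ?i (h n + x)) \<longlonglongrightarrow> ?i x"
      proof (cases "x \<in> U")
        case True
        have "(\<lambda>n. h n + x) \<longlonglongrightarrow> x"
          using tendsto_add[OF h tendsto_const[of x]] by simp
        then have "\<forall>\<^sub>F n in sequentially. h n + x \<in> U"
          using True U(1) by (auto simp: tendsto_def)
        then have "\<forall>\<^sub>F n in sequentially. ?i x * ?i (h n + x) = ?i x"
          by eventually_elim (use True in auto)
        then show ?thesis by (rule tendsto_eventually)
      qed simp
    qed
  qed (use int in \<open>auto simp: indicator_def\<close>)
  have "(LINT x|lborel. norm (?i (h n + x) *\<^sub>R c - ?i x *\<^sub>R c))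
     = norm c * (2 * (LINT x|lborel. ?i x) - 2 * (LINT x|lborel. ?i x * ?i (h n + x)))" for n
  proof -
    have "(LINT x|lborel. norm (?i (h n + x) *\<^sub>R c - ?i x *\<^sub>R c))
      = (LINT x|lborel. norm c * (?i (h n + x) + ?i x - 2 * (?i x * ?i (h n + x))))"
      by (intro Bochner_Integration.integral_cong) (auto simp: indicator_def)
    also have "\<dots> = norm c * ((LINT x|lborel. ?i (h n + x)) + (LINT x|lborel. ?i x) - 2 * (LINT x|lborel. ?i x * ?i (h n + x)))"
      using int int' prod by simp
    also have "(LINT x|lborel. ?i (h n + x)) = (LINT x|lborel. ?i x)"
      by (rule integral_lborel_translate) simp
    finally show ?thesis by simp
  qed
  moreover have "(\<lambda>n. norm c * (2 * (LINT x|lborel. ?i x) - 2 * (LINT x|lborel. ?i x * ?i (h n + x)))) \<longlonglongrightarrow> 0"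
    by (rule tendsto_eq_intros lim refl)+ simp
  ultimately show ?thesis by simp
qed

text \<open>Induction over integrable functions: indicators of Borel sets are approximated by those
  of open sets through outer regularity, sums follow from the triangle inequality, and limits are
  again a case of approximation in \<open>L\<^sup>1\<close>.\<close>

lemma tendsto_translate_L1:
  fixes f :: "'a::euclidean_space \<Rightarrow> 'b::{banach, second_countable_topology}"
  assumes "integrable lborel f" and h: "h \<longlonglongrightarrow> 0"
  shows "(\<lambda>n. LINT x|lborel. norm (f (h n + x) - f x)) \<longlonglongrightarrow> 0"
  using assms(1)
proof (induction f rule: integrable_induct)
  case (base A c)
  note [measurable] = base(1)
  show ?case
  proof (rule tendsto_translate_L1_approx)
    show "integrable lborel (\<lambda>x. indicator A x *\<^sub>R c)"
      using base by (intro integrable_scaleR_left) simp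
    fix e :: real assume "e > 0"
    \<comment> \<open>Adding 1 avoids a division by zero for \<open>c = 0\<close> and makes the
      final inequality strict.\<close>
    define e' where "e' = e / (norm c + 1)"
    have e': "(norm c + 1) * e' = e"
      using norm_ge_zero[of c] by (simp add: e'_def del: norm_ge_zero)
    have "e' > 0" using \<open>e > 0\<close> by (simp add: e'_def add_nonneg_pos)
    obtain U where U: "open U" "A \<subseteq> U" "emeasure lborel (U - A) < e'"
      using outer_regular_lborel[of A e'] base(1) \<open>e' > 0\<close> by auto
    have [measurable]: "U \<in> sets borel" using U by simp
    have "emeasure lborel U \<le> emeasure lborel A + emeasure lborel (U - A)"
      using U(2) emeasure_subadditive[of A lborel "U - A"] base(1) by (simp add: Un_absorb1)
    also have "\<dots> < \<infinity>"
      using base(2) U(3) by (simp add: less_top order.strict_trans)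
    finally have fin: "emeasure lborel U < \<infinity>" .
    show "\<exists>g. integrable lborel g \<and> (LINT x|lborel. norm (indicator A x *\<^sub>R c - g x)) < e \<and>
        (\<lambda>n. LINT x|lborel. norm (g (h n + x) - g x)) \<longlonglongrightarrow> 0"
    proof (intro exI conjI)
      show "integrable lborel (\<lambda>x. indicator U x *\<^sub>R c)"
        using fin by (intro integrable_scaleR_left) simp
      have "(LINT x|lborel. norm (indicator A x *\<^sub>R c - indicator U x *\<^sub>R c))
          = (LINT x|lborel. norm c * indicator (U - A) x)"
        using U(2) by (intro Bochner_Integration.integral_cong) (auto simp: indicator_def)
      also have "\<dots> = norm c * measure lborel (U - A)" by simp
      also have "\<dots> \<le> norm c * e'"
        using U(3) \<open>e' > 0\<close> by (intro mult_left_mono)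
          (auto simp: measure_def enn2real_leI less_imp_le)
      also have "\<dots> < e"
        using e' \<open>e' > 0\<close> by (simp add: algebra_simps)
      finally show "(LINT x|lborel. norm (indicator A x *\<^sub>R c - indicator U x *\<^sub>R c)) < e" .
    qed (rule tendsto_translate_L1_open[OF U(1) fin h])
  qed
next
  case (add f g)
  show ?case
  proof (rule Lim_null_comparison)
    show "(\<lambda>n. (LINT x|lborel. norm (f (h n + x) - f x)) + (LINT x|lborel. norm (g (h n + x) - g x))) \<longlonglongrightarrow> 0"
      using tendsto_add[OF add(3,4)] by simp
    show "\<forall>\<^sub>F n in sequentially. norm (LINT x|lborel. norm (f (h n + x) + g (h n + x) - (f x + g x)))
      \<le> (LINT x|lborel. norm (f (h n + x) - f x)) + (LINT x|lborel. norm (g (h n + x) - g x))"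
    proof (intro always_eventually allI)
      fix n
      note int = add(1,2) integrable_lborel_translate[OF add(1), of "h n"] integrable_lborel_translate[OF add(2), of "h n"]
      have "(LINT x|lborel. norm (f (h n + x) + g (h n + x) - (f x + g x)))
        \<le> (LINT x|lborel. norm (f (h n + x) - f x) + norm (g (h n + x) - g x))"
        using int by (intro integral_mono) (auto simp: norm_diff_triangle_ineq)
      also have "\<dots> = (LINT x|lborel. norm (f (h n + x) - f x)) + (LINT x|lborel. norm (g (h n + x) - g x))"
        using int by simp
      finally show "norm (LINT x|lborel. norm (f (h n + x) + g (h n + x) - (f x + g x)))
        \<le> (LINT x|lborel. norm (f (h n + x) - f x)) + (LINT x|lborel. norm (g (h n + x) - g x))"
        by simp
    qed
  qed
next
  case (lim f s)
  show ?case
  proof (rule tendsto_translate_L1_approx[OF lim(4)])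
    fix e :: real assume "e > 0"
    note [measurable] = borel_measurable_integrable[OF lim(1)] borel_measurable_integrable[OF lim(4)]
    have "(\<lambda>i. LINT x|lborel. norm (f x - s i x)) \<longlonglongrightarrow> (LINT x::'a|lborel. (0::real))"
    \<comment> \<open>The induction rule supplies \<open>norm (s i x) \<le> 2 * norm (f x)\<close>,
      and the difference adds one more \<open>norm (f x)\<close>.\<close>
    proof (rule integral_dominated_convergence[where w="\<lambda>x. 3 * norm (f x)"])
      show "AE x in lborel. (\<lambda>i. norm (f x - s i x)) \<longlonglongrightarrow> 0"
        using lim(2) by (intro AE_I2 tendsto_norm_zero) (auto intro!: tendsto_eq_intros)
      show "AE x in lborel. norm (norm (f x - s i x)) \<le> 3 * norm (f x)" for i
        using lim(3)[of _ i] by (intro AE_I2) (auto intro: order_trans[OF norm_triangle_ineq4])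
    qed (use lim(4) in auto)
    from order_tendstoD(2)[OF this, of e] \<open>e > 0\<close>
    obtain i where "(LINT x|lborel. norm (f x - s i x)) < e"
      by (auto simp: eventually_sequentially)
    then show "\<exists>g. integrable lborel g \<and> (LINT x|lborel. norm (f x - g x)) < e \<and>
        (\<lambda>n. LINT x|lborel. norm (g (h n + x) - g x)) \<longlonglongrightarrow> 0"
      using lim(1,5) by blast
  qed
qed

text \<open>
  The map \<open>a \<mapsto> \<bar>a\<bar> a\<close> carries \<open>L\<^sup>2\<close> to \<open>L\<^sup>1\<close>; this inequality is the Hoelder continuity of its inverse.
\<close>

lemma norm_diff_power2_le_mazur:
  fixes a b :: "'a::real_inner"
  shows "(norm (a - b))\<^sup>2 \<le> 2 * norm (norm a *\<^sub>R a - norm b *\<^sub>R b)"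
proof (cases "a = b")
  case False
  define u where "u = norm a *\<^sub>R a - norm b *\<^sub>R b"
  define p q r where "p = norm a" and "q = norm b" and "r = norm (a - b)"
  have nn: "p \<ge> 0" "q \<ge> 0" "r > 0" "r \<le> p + q"
    using False norm_triangle_ineq4[of a b] by (auto simp: p_def q_def r_def)
  have ab: "2 * (a \<bullet> b) = p\<^sup>2 + q\<^sup>2 - r\<^sup>2"
    by (simp add: p_def q_def r_def power2_norm_eq_inner inner_diff inner_commute)
  \<comment> \<open>Pairing \<open>u\<close> with \<open>a - b\<close> gives an exact formula in
    \<open>p\<close>, \<open>q\<close>, \<open>r\<close>. Dropping its square term and using
    \<open>r \<le> p + q\<close> leaves \<open>r^3\<close>, while Cauchy-Schwarz bounds the pairing
    by \<open>r * norm u\<close>.\<close>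
  have "u \<bullet> (a - b) = p * (a \<bullet> a) + q * (b \<bullet> b) - (p + q) * (a \<bullet> b)"
    by (simp add: u_def p_def q_def inner_diff_left inner_diff_right inner_commute[of b a] algebra_simps)
  then have "2 * (u \<bullet> (a - b)) = 2 * p^3 + 2 * q^3 - (p + q) * (2 * (a \<bullet> b))"
    by (simp add: p_def q_def power3_eq_cube algebra_simps power2_eq_square flip: power2_norm_eq_inner)
  also have "\<dots> = (p + q) * r\<^sup>2 + (p + q) * (p - q)\<^sup>2"
    unfolding ab by (simp add: power2_eq_square power3_eq_cube algebra_simps)
  also have "\<dots> \<ge> r * r\<^sup>2"
    using nn by (intro order_trans[OF mult_right_mono[of r "p + q" "r\<^sup>2"]]) auto
  finally have "r * r\<^sup>2 \<le> 2 * (u \<bullet> (a - b))" .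
  also have "\<dots> \<le> r * (2 * norm u)"
    using norm_cauchy_schwarz[of u "a - b"] by (simp add: r_def mult.commute)
  finally show ?thesis
    using nn by (simp add: r_def u_def)
qed simp

text \<open>No second density argument is made: \<open>g = \<bar>f\<bar> f\<close> is integrable,
  the map from \<open>f\<close> to \<open>g\<close> commutes with translations, and
  \<open>norm_diff_power2_le_mazur\<close> bounds the squared \<open>L\<^sup>2\<close> distance by
  twice the \<open>L\<^sup>1\<close> distance.\<close>

lemma tendsto_translate_L2:
  fixes f :: "'a::euclidean_space \<Rightarrow> complex"
  assumes f: "f \<in> L2_space" and h: "h \<longlonglongrightarrow> 0"
  shows "(\<lambda>n. L2_norm (\<lambda>x. f (h n + x) - f x)) \<longlonglongrightarrow> 0"
proof -
  note [measurable] = L2_space_measurable[OF f]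
  define g where "g x = cmod (f x) *\<^sub>R f x" for x
  have g: "integrable lborel g"
  proof (rule Bochner_Integration.integrable_bound[OF L2_space_integrable[OF f]])
    show "g \<in> borel_measurable lborel" unfolding g_def by simp
  qed (simp add: g_def power2_eq_square)
  have "(\<lambda>n. 2 * (LINT x|lborel. norm (g (h n + x) - g x))) \<longlonglongrightarrow> 0"
    using tendsto_translate_L1[OF g h] by (rule tendsto_mult_right_zero)
  moreover have "(LINT x|lborel. (cmod (f (h n + x) - f x))\<^sup>2) \<le> 2 * (LINT x|lborel. norm (g (h n + x) - g x))" for n
  proof -
    have int: "integrable lborel (\<lambda>x. 2 * norm (g (h n + x) - g x))"
      using g integrable_lborel_translate[OF g, of "h n"] by simp
    have le: "(cmod (f (h n + x) - f x))\<^sup>2 \<le> 2 * norm (g (h n + x) - g x)" for x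
      unfolding g_def by (rule norm_diff_power2_le_mazur)
    have "(LINT x|lborel. (cmod (f (h n + x) - f x))\<^sup>2) \<le> (LINT x|lborel. 2 * norm (g (h n + x) - g x))"
      by (rule integral_mono[OF Bochner_Integration.integrable_bound[OF int] int le])
        (use le in \<open>auto\<close>)
    then show ?thesis by simp
  qed
  ultimately have "(\<lambda>n. LINT x|lborel. (cmod (f (h n + x) - f x))\<^sup>2) \<longlonglongrightarrow> 0"
    by (elim Lim_null_comparison[OF always_eventually, OF allI, rotated]) simp_all
  then show ?thesis
    unfolding L2_norm_def using tendsto_real_sqrt by fastforce
qed

subsection \<open>Gaussians\<close>

text \<open>\<open>lborel\<close> is the image of a product of one-dimensional Lebesgue measures
  under the coordinate map, so functions that factor over the coordinates reduce to dimension
  one.\<close>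

lemma
  fixes f :: "'a::euclidean_space \<Rightarrow> real \<Rightarrow> 'b::{real_normed_field, banach, second_countable_topology}"
  assumes f: "\<And>b. b \<in> Basis \<Longrightarrow> integrable lborel (f b)"
  shows integrable_lborel_prod_Basis: "integrable lborel (\<lambda>x. \<Prod>b\<in>Basis. f b (x \<bullet> b))"
    and integral_lborel_prod_Basis: "(LINT x|lborel. (\<Prod>b\<in>Basis. f b (x \<bullet> b))) = (\<Prod>b\<in>Basis. (LINT t|lborel. f b t))"
proof -
  interpret product_sigma_finite "\<lambda>b::'a. lborel :: real measure" ..
  have [measurable]: "f b \<in> borel_measurable borel" if "b \<in> Basis" for b
    using f[OF that] by auto
  have *: "(\<Prod>b\<in>Basis. f b ((\<Sum>c\<in>Basis. x c *\<^sub>R c) \<bullet> b)) = (\<Prod>b\<in>Basis. f b (x b))" for x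
    by (intro prod.cong) auto
  show "integrable lborel (\<lambda>x. \<Prod>b\<in>Basis. f b (x \<bullet> b))"
    unfolding lborel_eq[where 'a='a]
    by (subst integrable_distr_eq) (auto simp: * intro!: product_integrable_prod f)
  show "(LINT x|lborel. (\<Prod>b\<in>Basis. f b (x \<bullet> b))) = (\<Prod>b\<in>Basis. (LINT t|lborel. f b t))"
    unfolding lborel_eq[where 'a='a]
    by (subst integral_distr) (auto simp: * lborel_eq_real[symmetric] intro!: product_integral_prod f)
qed

lemma integral_lborel_scale:
  fixes f :: "'a::euclidean_space \<Rightarrow> 'b::{banach, second_countable_topology}"
  assumes [measurable]: "f \<in> borel_measurable borel" and c: "c > 0"
  shows "(LINT x|lborel. f x) = (LINT x|lborel. c ^ DIM('a) *\<^sub>R f (c *\<^sub>R x))"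
proof -
  have "(LINT x|lborel. f x) = (LINT x|density (distr lborel borel (\<lambda>x. 0 + c *\<^sub>R x)) (\<lambda>_. ennreal (c ^ DIM('a))). f x)"
    using lborel_affine[of c "0::'a"] c by simp
  also have "\<dots> = (LINT x|lborel. c ^ DIM('a) *\<^sub>R f (c *\<^sub>R x))"
    using c by (subst integral_density) (auto simp: integral_distr)
  finally show ?thesis .
qed

definition gauss_weight :: "real \<Rightarrow> 'a::euclidean_space \<Rightarrow> real" where
  "gauss_weight \<sigma> \<xi> = exp (- (\<sigma> * norm \<xi>)\<^sup>2 / 2)"

text \<open>The Fourier transform of \<open>gauss_weight \<sigma>\<close> in the normalisation with
  \<open>2 * pi\<close> in the exponent, which is where the standard deviation
  \<open>\<sigma> / (2 * pi)\<close> comes from. For \<sigma> tending to 0 the weights tend to 1 and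
  the kernels concentrate at the origin.\<close>

definition gauss_kernel :: "real \<Rightarrow> 'a::euclidean_space \<Rightarrow> real" where
  "gauss_kernel \<sigma> x = (\<Prod>b\<in>Basis. normal_density 0 (\<sigma> / (2 * pi)) (x \<bullet> b))"

lemma gauss_weight_measurable [measurable]: "gauss_weight \<sigma> \<in> borel_measurable borel"
  unfolding gauss_weight_def by measurable

lemma gauss_weight_prod: "gauss_weight \<sigma> \<xi> = (\<Prod>b\<in>Basis. exp (- (\<sigma> * (\<xi> \<bullet> b))\<^sup>2 / 2))"
proof -
  have "(norm \<xi>)\<^sup>2 = (\<Sum>b\<in>Basis. (\<xi> \<bullet> b)\<^sup>2)"
    by (simp only: power2_norm_eq_inner euclidean_inner[of \<xi> \<xi>]) (simp add: power2_eq_square)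
  then show ?thesis
    by (simp add: gauss_weight_def exp_sum[symmetric] power_mult_distrib sum_distrib_left sum_negf sum_divide_distrib)
qed

lemma borel_measurable_cis [measurable]: "cis \<in> borel_measurable borel"
  by (intro borel_measurable_continuous_onI continuous_intros)

text \<open>A rescaling of the characteristic function \<open>exp (- u\<^sup>2 / 2)\<close> of the
  standard normal distribution.\<close>

lemma gauss_1d:
  fixes \<sigma> t :: real
  assumes "\<sigma> > 0"
  shows "integrable lborel (\<lambda>s. exp (- (\<sigma> * s)\<^sup>2 / 2))"
    and "(LINT s|lborel. cis (- 2 * pi * (s * t)) * complex_of_real (exp (- (\<sigma> * s)\<^sup>2 / 2)))
      = complex_of_real (normal_density 0 (\<sigma> / (2 * pi)) t)"
proof -
  have e: "exp (- s\<^sup>2 / 2) = sqrt (2 * pi) * std_normal_density s" for s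
    by (simp add: std_normal_density_def)
  have "integrable lborel (\<lambda>s::real. exp (- s\<^sup>2 / 2))"
    unfolding e by (intro integrable_mult_right integrable_normal_density) simp
  from lborel_integrable_real_affine[OF this, of \<sigma> 0] assms
  show "integrable lborel (\<lambda>s. exp (- (\<sigma> * s)\<^sup>2 / 2))" by simp
  \<comment> \<open>The frequency after the substitution of \<open>\<sigma> * s\<close> for
    \<open>s\<close>: \<open>u * (\<sigma> * s)\<close> is the phase
    \<open>- 2 * pi * (s * t)\<close>.\<close>
  define u where "u = - 2 * pi * t / \<sigma>"
  have "complex_of_real (exp (- (u\<^sup>2) / 2)) = (LINT s|std_normal_distribution. cis (u * s))"
    using fun_cong[OF char_std_normal_distribution, of u]
    by (simp add: char_def cis_conv_exp)
  also have "\<dots> = (LINT s|lborel. std_normal_density s *\<^sub>R cis (u * s))"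
    by (rule integral_density) (auto simp: normal_density_nonneg)
  also have "\<dots> = \<sigma> *\<^sub>R (LINT s|lborel. std_normal_density (\<sigma> * s) *\<^sub>R cis (u * (\<sigma> * s)))"
    using lborel_integral_real_affine[of \<sigma> "\<lambda>s. std_normal_density s *\<^sub>R cis (u * s)" 0] assms by simp
  also have "\<dots> = \<sigma> *\<^sub>R (LINT s|lborel. complex_of_real (1 / sqrt (2 * pi))
      * (cis (- 2 * pi * (s * t)) * complex_of_real (exp (- (\<sigma> * s)\<^sup>2 / 2))))"
    using assms by (simp add: std_normal_density_def scaleR_conv_of_real u_def mult_ac)
  also have "\<dots> = complex_of_real (\<sigma> / sqrt (2 * pi)) * (LINT s|lborel. cis (- 2 * pi * (s * t)) * complex_of_real (exp (- (\<sigma> * s)\<^sup>2 / 2)))"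
    by (subst integral_mult_right_zero) (simp add: scaleR_conv_of_real)
  finally have *: "(LINT s|lborel. cis (- 2 * pi * (s * t)) * complex_of_real (exp (- (\<sigma> * s)\<^sup>2 / 2)))
     = complex_of_real (exp (- (u\<^sup>2) / 2) * (sqrt (2 * pi) / \<sigma>))"
    using assms by (simp add: field_simps)
  have "sqrt (2 * pi) / \<sigma> = 1 / sqrt (2 * pi * (\<sigma> / (2 * pi))\<^sup>2)"
    using assms by (simp add: real_sqrt_mult real_sqrt_divide power_divide field_simps)
  moreover have "- (u\<^sup>2) / 2 = - ((t - 0)\<^sup>2) / (2 * (\<sigma> / (2 * pi))\<^sup>2)"
    using assms by (simp add: u_def power_divide power_mult_distrib)
  ultimately have nd: "exp (- (u\<^sup>2) / 2) * (sqrt (2 * pi) / \<sigma>) = normal_density 0 (\<sigma> / (2 * pi)) t"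
    unfolding normal_density_def by (simp only: mult.commute)
  show "(LINT s|lborel. cis (- 2 * pi * (s * t)) * complex_of_real (exp (- (\<sigma> * s)\<^sup>2 / 2)))
      = complex_of_real (normal_density 0 (\<sigma> / (2 * pi)) t)"
    unfolding * nd by (rule refl)
qed

lemma integrable_gauss_weight:
  assumes "\<sigma> > 0"
  shows "integrable lborel (gauss_weight \<sigma> :: 'a::euclidean_space \<Rightarrow> real)"
  unfolding gauss_weight_prod[abs_def]
  by (rule integrable_lborel_prod_Basis) (rule gauss_1d[OF assms])

lemma cis_sum: "finite A \<Longrightarrow> cis (\<Sum>b\<in>A. f b) = (\<Prod>b\<in>A. cis (f b))"
  by (induction rule: finite_induct) (auto simp: cis_mult[symmetric])

text \<open>Both the phase and the Gaussian factor over the coordinates.\<close>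

lemma fourier_integral_gauss_weight:
  fixes x :: "'a::euclidean_space"
  assumes "\<sigma> > 0"
  shows "fourier_integral (\<lambda>\<xi>. complex_of_real (gauss_weight \<sigma> \<xi>)) x = complex_of_real (gauss_kernel \<sigma> x)"
proof -
  have "cis (- 2 * pi * (\<xi> \<bullet> x)) = (\<Prod>b\<in>Basis. cis (- 2 * pi * ((\<xi> \<bullet> b) * (x \<bullet> b))))" for \<xi>
    by (simp only: cis_sum[symmetric] finite_Basis sum_distrib_left[symmetric] euclidean_inner[symmetric])
  then have "fourier_integral (\<lambda>\<xi>. complex_of_real (gauss_weight \<sigma> \<xi>)) x
     = (LINT \<xi>|lborel. (\<Prod>b\<in>Basis. (\<lambda>b s. cis (- 2 * pi * (s * (x \<bullet> b))) * complex_of_real (exp (- (\<sigma> * s)\<^sup>2 / 2))) b (\<xi> \<bullet> b)))"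
    unfolding fourier_integral_def gauss_weight_prod by (simp add: prod.distrib)
  also have "\<dots> = complex_of_real (gauss_kernel \<sigma> x)"
  proof (subst integral_lborel_prod_Basis)
    fix b :: 'a
    show "integrable lborel (\<lambda>s. cis (- 2 * pi * (s * (x \<bullet> b))) * complex_of_real (exp (- (\<sigma> * s)\<^sup>2 / 2)))"
      by (rule Bochner_Integration.integrable_bound[OF gauss_1d(1)[OF assms]]) (auto simp: norm_mult)
  qed (simp only: gauss_1d(2)[OF assms] gauss_kernel_def of_real_prod)
  finally show ?thesis .
qed

lemma gauss_kernel_nonneg [simp]: "gauss_kernel \<sigma> x \<ge> 0"
  by (auto simp: gauss_kernel_def intro!: prod_nonneg normal_density_nonneg)

lemma gauss_kernel_measurable [measurable]: "gauss_kernel \<sigma> \<in> borel_measurable borel"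
  unfolding gauss_kernel_def by measurable

lemma
  shows integrable_gauss_kernel: "integrable lborel (gauss_kernel 1 :: 'a::euclidean_space \<Rightarrow> real)"
    and integral_gauss_kernel: "(LINT x|lborel. gauss_kernel 1 (x::'a)) = 1"
proof -
  show "integrable lborel (gauss_kernel 1 :: 'a \<Rightarrow> real)"
    unfolding gauss_kernel_def by (rule integrable_lborel_prod_Basis) (rule integrable_normal_density, simp)
  show "(LINT x|lborel. gauss_kernel 1 (x::'a)) = 1"
    unfolding gauss_kernel_def by (subst integral_lborel_prod_Basis) auto
qed

text \<open>With this, a change of variables moves the dependence on \<sigma> out of the kernel and
  into the other factor, so that a fixed integrable kernel can dominate the limit.\<close>

lemma gauss_kernel_scale:
  fixes x :: "'a::euclidean_space"
  assumes "\<sigma> > 0"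
  shows "\<sigma> ^ DIM('a) * gauss_kernel \<sigma> (\<sigma> *\<^sub>R x) = gauss_kernel 1 x"
proof -
  have "\<sigma> * normal_density 0 (\<sigma> / (2 * pi)) (\<sigma> * t) = normal_density 0 (1 / (2 * pi)) t" for t
  proof -
    have "\<sigma> / sqrt (2 * pi * (\<sigma> / (2 * pi))\<^sup>2) = 1 / sqrt (2 * pi * (1 / (2 * pi))\<^sup>2)"
      using assms by (simp add: real_sqrt_mult real_sqrt_divide power_divide field_simps)
    moreover have "- (\<sigma> * t)\<^sup>2 / (2 * (\<sigma> / (2 * pi))\<^sup>2) = - t\<^sup>2 / (2 * (1 / (2 * pi))\<^sup>2)"
      using assms by (simp add: power_divide power_mult_distrib)
    ultimately show ?thesis
      unfolding normal_density_def by (simp add: field_simps)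
  qed
  then have "(\<Prod>b\<in>Basis. \<sigma> * normal_density 0 (\<sigma> / (2 * pi)) (\<sigma> * (x \<bullet> b))) = gauss_kernel 1 x"
    by (simp add: gauss_kernel_def)
  then show ?thesis
    by (simp add: gauss_kernel_def prod.distrib)
qed

subsection \<open>The Plancherel theorem\<close>

lemma borel_measurable_cnj [measurable]: "cnj \<in> borel_measurable borel"
  by (intro borel_measurable_continuous_onI continuous_intros)

lemma integrable_lborel_pair_mult:
  fixes f :: "'a::euclidean_space \<Rightarrow> complex" and g :: "'b::euclidean_space \<Rightarrow> complex"
  assumes f: "integrable lborel f" and g: "integrable lborel g"
  shows "integrable (lborel \<Otimes>\<^sub>M lborel) (\<lambda>(x, y). f x * g y)"
proof -
  note [measurable] = borel_measurable_integrable[OF f] borel_measurable_integrable[OF g]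
  show ?thesis
  proof (rule lborel_pair.Fubini_integrable)
    show "integrable lborel (\<lambda>x. LINT y|lborel. norm (case (x, y) of (x, y) \<Rightarrow> f x * g y))"
      using f by (simp add: norm_mult)
  qed (use g in auto)
qed

lemma integrable_cis_mult:
  fixes f :: "'a::euclidean_space \<Rightarrow> complex" and a :: "'a \<Rightarrow> real"
  assumes f: "integrable lborel f" and [measurable]: "a \<in> borel_measurable borel"
  shows "integrable lborel (\<lambda>x. cis (a x) * f x)"
  by (rule Bochner_Integration.integrable_bound[OF f])
    (use borel_measurable_integrable[OF f] in \<open>auto simp: norm_mult\<close>)

lemma fourier_integral_measurable [measurable]:
  assumes [measurable]: "f \<in> borel_measurable borel"
  shows "fourier_integral f \<in> borel_measurable (borel :: 'a::euclidean_space measure)"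
proof -
  have "(\<lambda>\<xi>. LINT x|lborel. cis (- 2 * pi * (x \<bullet> \<xi>)) * f x) \<in> borel_measurable (borel :: 'a measure)"
    by (rule lborel.borel_measurable_lebesgue_integral) measurable
  then show ?thesis
    by (simp add: fourier_integral_def[abs_def])
qed

lemma cmod_fourier_integral_le:
  "cmod (fourier_integral f \<xi>) \<le> (LINT x|lborel. cmod (f x))"
  using integral_norm_bound[of lborel "\<lambda>x. cis (- 2 * pi * (x \<bullet> \<xi>)) * f x"]
  by (simp add: fourier_integral_def norm_mult)

lemma fourier_integral_diff:
  assumes "integrable lborel f" "integrable lborel g"
  shows "fourier_integral (\<lambda>x. f x - g x) \<xi> = fourier_integral f \<xi> - fourier_integral g \<xi>"
proof -
  have "integrable lborel (\<lambda>x. cis (- 2 * pi * (x \<bullet> \<xi>)) * f x)"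
    "integrable lborel (\<lambda>x. cis (- 2 * pi * (x \<bullet> \<xi>)) * g x)"
    using assms by (auto intro!: integrable_cis_mult)
  then show ?thesis
    by (simp add: fourier_integral_def right_diff_distrib)
qed

text \<open>The multiplication formula: Fubini applied to a phase that is symmetric in the two
  variables.\<close>

lemma integral_fourier_integral_mult:
  fixes f g :: "'a::euclidean_space \<Rightarrow> complex"
  assumes f: "integrable lborel f" and g: "integrable lborel g"
  shows "(LINT x|lborel. fourier_integral f x * g x) = (LINT x|lborel. f x * fourier_integral g x)"
proof -
  note [measurable] = borel_measurable_integrable[OF f] borel_measurable_integrable[OF g]
  have "integrable (lborel \<Otimes>\<^sub>M lborel) (\<lambda>(y, x). cis (- 2 * pi * (y \<bullet> x)) * (f y * g x))"
    by (rule Bochner_Integration.integrable_bound[OF integrable_lborel_pair_mult[OF f g]])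
      (auto simp: norm_mult split: prod.split)
  from lborel_pair.Fubini_integral[OF this]
  have "(LINT x|lborel. (LINT y|lborel. (cis (- 2 * pi * (y \<bullet> x)) * f y) * g x))
      = (LINT y|lborel. (LINT x|lborel. f y * (cis (- 2 * pi * (x \<bullet> y)) * g x)))"
    by (simp add: mult_ac inner_commute)
  then show ?thesis
    by (simp add: fourier_integral_def)
qed

section \<open>Autocorrelation and preservation of the norm\<close>

definition autocorr :: "('a::euclidean_space \<Rightarrow> complex) \<Rightarrow> 'a \<Rightarrow> complex" where
  "autocorr f z = (LINT y|lborel. f (z + y) * cnj (f y))"

text \<open>Integrating first over \<open>z\<close>, a translation by \<open>y\<close> turns the
  inner integral into one that no longer involves \<open>y\<close>. For the transform the phase at
  \<open>z\<close> splits into the phase at \<open>y + z\<close> and the conjugate phase at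
  \<open>y\<close>, so the double integral becomes the transform times its conjugate.\<close>

lemma
  fixes f :: "'a::euclidean_space \<Rightarrow> complex"
  assumes f: "integrable lborel f"
  shows integrable_autocorr: "integrable lborel (autocorr f)"
    and fourier_integral_autocorr:
      "fourier_integral (autocorr f) \<xi> = complex_of_real ((cmod (fourier_integral f \<xi>))\<^sup>2)"
proof -
  note [measurable] = borel_measurable_integrable[OF f]
  have int: "integrable (lborel \<Otimes>\<^sub>M lborel) (\<lambda>(y, z). f (z + y) * cnj (f y))"
  proof (rule lborel_pair.Fubini_integrable)
    have "(LINT z|lborel. norm (case (y, z) of (y, z) \<Rightarrow> f (z + y) * cnj (f y)))
        = cmod (f y) * (LINT z|lborel. cmod (f z))" for y
      using integral_lborel_translate[of "\<lambda>z. cmod (f z)" y]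
      by (simp add: norm_mult add.commute)
    then show "integrable lborel (\<lambda>y. LINT z|lborel. norm (case (y, z) of (y, z) \<Rightarrow> f (z + y) * cnj (f y)))"
      using f by simp
    show "AE y in lborel. integrable lborel (\<lambda>z. case (y, z) of (y, z) \<Rightarrow> f (z + y) * cnj (f y))"
      using integrable_lborel_translate[OF f] by (simp add: add.commute)
  qed measurable
  show "integrable lborel (autocorr f)"
    using lborel_pair.integrable_snd[OF int] by (simp add: autocorr_def[abs_def])
  have "integrable (lborel \<Otimes>\<^sub>M lborel) (\<lambda>(y, z). cis (- 2 * pi * (z \<bullet> \<xi>)) * (f (z + y) * cnj (f y)))"
    by (rule Bochner_Integration.integrable_bound[OF int]) (auto simp: norm_mult split: prod.split)
  from lborel_pair.Fubini_integral[OF this]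
  have "fourier_integral (autocorr f) \<xi>
      = (LINT y|lborel. (LINT z|lborel. cis (- 2 * pi * (z \<bullet> \<xi>)) * (f (z + y) * cnj (f y))))"
    by (simp add: fourier_integral_def autocorr_def)
  also have "\<dots> = (LINT y|lborel. cnj (cis (- 2 * pi * (y \<bullet> \<xi>)) * f y) * fourier_integral f \<xi>)"
  proof (intro Bochner_Integration.integral_cong refl)
    fix y
    have "(LINT z|lborel. cis (- 2 * pi * (z \<bullet> \<xi>)) * (f (z + y) * cnj (f y)))
        = (LINT z|lborel. cnj (cis (- 2 * pi * (y \<bullet> \<xi>)) * f y) * (cis (- 2 * pi * ((y + z) \<bullet> \<xi>)) * f (y + z)))"
    proof (intro Bochner_Integration.integral_cong refl)
      fix z
      have "cis (- 2 * pi * (z \<bullet> \<xi>)) = cnj (cis (- 2 * pi * (y \<bullet> \<xi>))) * cis (- 2 * pi * ((y + z) \<bullet> \<xi>))"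
        by (simp add: cis_cnj cis_mult inner_add_left algebra_simps)
      then show "cis (- 2 * pi * (z \<bullet> \<xi>)) * (f (z + y) * cnj (f y))
        = cnj (cis (- 2 * pi * (y \<bullet> \<xi>)) * f y) * (cis (- 2 * pi * ((y + z) \<bullet> \<xi>)) * f (y + z))"
        by (simp add: mult_ac add.commute)
    qed
    also have "\<dots> = cnj (cis (- 2 * pi * (y \<bullet> \<xi>)) * f y) * fourier_integral f \<xi>"
      using integral_lborel_translate[of "\<lambda>z. cis (- 2 * pi * (z \<bullet> \<xi>)) * f z" y]
      by (simp add: fourier_integral_def)
    finally show "(LINT z|lborel. cis (- 2 * pi * (z \<bullet> \<xi>)) * (f (z + y) * cnj (f y)))
      = cnj (cis (- 2 * pi * (y \<bullet> \<xi>)) * f y) * fourier_integral f \<xi>" .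
  qed
  also have "\<dots> = cnj (fourier_integral f \<xi>) * fourier_integral f \<xi>"
    by (simp only: integral_mult_left_zero Bochner_Integration.integral_cnj fourier_integral_def)
  also have "\<dots> = complex_of_real ((cmod (fourier_integral f \<xi>))\<^sup>2)"
    by (metis complex_norm_square mult.commute of_real_power)
  finally show "fourier_integral (autocorr f) \<xi> = complex_of_real ((cmod (fourier_integral f \<xi>))\<^sup>2)" .
qed

lemma L2_translate:
  assumes f: "f \<in> L2_space"
  shows "(\<lambda>x. f (h + x)) \<in> L2_space" and "L2_norm (\<lambda>x. f (h + x)) = L2_norm f"
proof -
  note [measurable] = L2_space_measurable[OF f]
  show "(\<lambda>x. f (h + x)) \<in> L2_space"
    using integrable_lborel_translate[OF L2_space_integrable[OF f]] by (intro L2_spaceI) auto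
  show "L2_norm (\<lambda>x. f (h + x)) = L2_norm f"
    using integral_lborel_translate[of "\<lambda>x. (cmod (f x))\<^sup>2" h] by (simp add: L2_norm_def)
qed

lemma L2_integrable_mult_cnj:
  assumes "f \<in> L2_space" "g \<in> L2_space"
  shows "integrable lborel (\<lambda>x. f x * cnj (g x))"
  by (rule Bochner_Integration.integrable_bound[OF L2_integrable_mult_norm[OF assms]])
    (use assms[THEN L2_space_measurable] in \<open>auto simp: norm_mult\<close>)

lemma L2_Cauchy_Schwarz_cnj:
  assumes "f \<in> L2_space" "g \<in> L2_space"
  shows "cmod (LINT x|lborel. f x * cnj (g x)) \<le> L2_norm f * L2_norm g"
  using integral_norm_bound[of lborel "\<lambda>x. f x * cnj (g x)"] L2_Cauchy_Schwarz[OF assms]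
  by (simp add: norm_mult)

lemma autocorr_0: "autocorr f 0 = complex_of_real ((L2_norm f)\<^sup>2)"
  by (simp add: autocorr_def L2_norm_power2 complex_norm_square[symmetric] flip: of_real_power)

lemma cmod_autocorr_le:
  assumes "f \<in> L2_space"
  shows "cmod (autocorr f z) \<le> (L2_norm f)\<^sup>2"
  using L2_Cauchy_Schwarz_cnj[OF L2_translate(1)[OF assms] assms] L2_translate(2)[OF assms]
  by (simp add: autocorr_def power2_eq_square)

text \<open>By Cauchy-Schwarz the change of \<open>autocorr f\<close> is at most the
  \<open>L\<^sup>2\<close> distance of \<open>f\<close> from its translate times the norm of
  \<open>f\<close>.\<close>

lemma tendsto_autocorr:
  assumes f: "f \<in> L2_space" and h: "h \<longlonglongrightarrow> 0"
  shows "(\<lambda>n. autocorr f (h n)) \<longlonglongrightarrow> autocorr f 0"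
proof -
  have "(\<lambda>n. L2_norm (\<lambda>x. f (h n + x) - f x) * L2_norm f) \<longlonglongrightarrow> 0"
    using tendsto_translate_L2[OF f h] by (rule tendsto_mult_left_zero)
  moreover have "cmod (autocorr f (h n) - autocorr f 0) \<le> L2_norm (\<lambda>x. f (h n + x) - f x) * L2_norm f" for n
  proof -
    have "autocorr f (h n) - autocorr f 0 = (LINT x|lborel. (f (h n + x) - f x) * cnj (f x))"
      using L2_integrable_mult_cnj[OF L2_translate(1)[OF f, of "h n"] f] L2_integrable_mult_cnj[OF f f]
      by (simp add: autocorr_def left_diff_distrib)
    then show ?thesis
      using L2_Cauchy_Schwarz_cnj[OF L2_space_diff[OF L2_translate(1)[OF f, of "h n"] f] f] by simp
  qed
  ultimately have "(\<lambda>n. autocorr f (h n) - autocorr f 0) \<longlonglongrightarrow> 0"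
    by (elim Lim_null_comparison[OF always_eventually, OF allI, rotated]) simp_all
  then show ?thesis
    by (simp add: LIM_zero_iff)
qed

text \<open>The boundedness of \<open>fourier_integral f\<close> makes the weighted integral finite
  before anything is known about its square integrability. The multiplication formula moves the
  transform onto the Gaussian, and scaling then moves \<sigma> into the argument of
  \<open>autocorr\<close>.\<close>

lemma
  fixes f :: "'a::euclidean_space \<Rightarrow> complex"
  assumes f: "integrable lborel f" "f \<in> L2_space" and \<sigma>: "\<sigma> > 0"
  shows integrable_gauss_fourier: "integrable lborel (\<lambda>\<xi>. gauss_weight \<sigma> \<xi> * (cmod (fourier_integral f \<xi>))\<^sup>2)"
    and integral_gauss_fourier: "complex_of_real (LINT \<xi>|lborel. gauss_weight \<sigma> \<xi> * (cmod (fourier_integral f \<xi>))\<^sup>2)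
      = (LINT z|lborel. complex_of_real (gauss_kernel 1 z) * autocorr f (\<sigma> *\<^sub>R z))"
proof -
  note [measurable] = borel_measurable_integrable[OF f(1)] borel_measurable_integrable[OF integrable_autocorr[OF f(1)]]
  let ?w = "\<lambda>\<xi>::'a. complex_of_real (gauss_weight \<sigma> \<xi>)"
  let ?C = "LINT x|lborel. cmod (f x)"
  show "integrable lborel (\<lambda>\<xi>. gauss_weight \<sigma> \<xi> * (cmod (fourier_integral f \<xi>))\<^sup>2)"
  proof (rule Bochner_Integration.integrable_bound)
    show "integrable lborel (\<lambda>\<xi>::'a. gauss_weight \<sigma> \<xi> * ?C\<^sup>2)"
      by (intro integrable_mult_left integrable_gauss_weight \<sigma>)
    show "AE \<xi> in lborel. norm (gauss_weight \<sigma> \<xi> * (cmod (fourier_integral f \<xi>))\<^sup>2) \<le> norm (gauss_weight \<sigma> \<xi> * ?C\<^sup>2)"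
      by (intro AE_I2) (auto simp: gauss_weight_def intro!: power_mono cmod_fourier_integral_le)
  qed simp
  have "complex_of_real (LINT \<xi>|lborel. gauss_weight \<sigma> \<xi> * (cmod (fourier_integral f \<xi>))\<^sup>2)
     = (LINT \<xi>|lborel. fourier_integral (autocorr f) \<xi> * ?w \<xi>)"
    unfolding fourier_integral_autocorr[OF f(1)]
    by (subst integral_complex_of_real[symmetric]) (simp add: mult.commute)
  also have "\<dots> = (LINT z|lborel. autocorr f z * fourier_integral ?w z)"
    using integrable_autocorr[OF f(1)] integrable_gauss_weight[OF \<sigma>]
    by (intro integral_fourier_integral_mult) auto
  also have "\<dots> = (LINT z|lborel. autocorr f z * complex_of_real (gauss_kernel \<sigma> z))"
    by (simp only: fourier_integral_gauss_weight[OF \<sigma>])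
  also have "\<dots> = (LINT z|lborel. \<sigma> ^ DIM('a) *\<^sub>R (autocorr f (\<sigma> *\<^sub>R z) * complex_of_real (gauss_kernel \<sigma> (\<sigma> *\<^sub>R z))))"
    by (rule integral_lborel_scale[OF _ \<sigma>]) measurable
  also have "\<dots> = (LINT z|lborel. complex_of_real (gauss_kernel 1 z) * autocorr f (\<sigma> *\<^sub>R z))"
    unfolding gauss_kernel_scale[OF \<sigma>, symmetric] by (simp add: scaleR_conv_of_real mult_ac)
  finally show "complex_of_real (LINT \<xi>|lborel. gauss_weight \<sigma> \<xi> * (cmod (fourier_integral f \<xi>))\<^sup>2)
      = (LINT z|lborel. complex_of_real (gauss_kernel 1 z) * autocorr f (\<sigma> *\<^sub>R z))" .
qed

text \<open>Both sides of \<open>integral_gauss_fourier\<close> are followed as \<sigma> tends to 0: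
  dominated convergence sends the kernel side to \<open>autocorr f 0\<close>, the squared norm of
  \<open>f\<close>, and monotone convergence sends the weighted side to the integral of
  \<open>\<bar>F f\<bar>\<^sup>2\<close>.\<close>

theorem Plancherel:
  fixes f :: "'a::euclidean_space \<Rightarrow> complex"
  assumes f: "integrable lborel f" "f \<in> L2_space"
  shows "fourier_integral f \<in> L2_space" and "L2_norm (fourier_integral f) = L2_norm f"
proof -
  note [measurable] = borel_measurable_integrable[OF f(1)] borel_measurable_integrable[OF integrable_autocorr[OF f(1)]]
  define \<sigma> :: "nat \<Rightarrow> real" where "\<sigma> n = 1 / Suc n" for n
  have \<sigma>: "\<sigma> n > 0" for n by (simp add: \<sigma>_def)
  have \<sigma>0: "\<sigma> \<longlonglongrightarrow> 0"
    unfolding \<sigma>_def using LIMSEQ_inverse_real_of_nat by (simp add: inverse_eq_divide)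
  have "(\<lambda>n. LINT z|lborel. complex_of_real (gauss_kernel 1 z) * autocorr f (\<sigma> n *\<^sub>R z))
      \<longlonglongrightarrow> (LINT z|lborel. complex_of_real (gauss_kernel 1 (z::'a)) * autocorr f 0)"
  proof (rule integral_dominated_convergence[where w="\<lambda>z. gauss_kernel 1 z * (L2_norm f)\<^sup>2"])
    show "integrable lborel (\<lambda>z::'a. gauss_kernel 1 z * (L2_norm f)\<^sup>2)"
      by (intro integrable_mult_left integrable_gauss_kernel)
    show "AE z in lborel. (\<lambda>n. complex_of_real (gauss_kernel 1 z) * autocorr f (\<sigma> n *\<^sub>R z))
        \<longlonglongrightarrow> complex_of_real (gauss_kernel 1 z) * autocorr f 0"
    proof (intro AE_I2 tendsto_mult tendsto_const tendsto_autocorr[OF f(2)])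
      show "(\<lambda>n. \<sigma> n *\<^sub>R z) \<longlonglongrightarrow> 0" for z :: 'a
        using tendsto_scaleR[OF \<sigma>0 tendsto_const[of z]] by simp
    qed
    show "AE z in lborel. norm (complex_of_real (gauss_kernel 1 z) * autocorr f (\<sigma> n *\<^sub>R z)) \<le> gauss_kernel 1 z * (L2_norm f)\<^sup>2" for n
      using cmod_autocorr_le[OF f(2)]
      by (intro AE_I2) (auto simp: norm_mult intro!: mult_left_mono)
  qed measurable
  also have "(LINT z|lborel. complex_of_real (gauss_kernel 1 (z::'a)) * autocorr f 0) = complex_of_real ((L2_norm f)\<^sup>2)"
    by (simp add: autocorr_0 integral_gauss_kernel)
  finally have "(\<lambda>n. complex_of_real (LINT \<xi>|lborel. gauss_weight (\<sigma> n) \<xi> * (cmod (fourier_integral f \<xi>))\<^sup>2)) \<longlonglongrightarrow> complex_of_real ((L2_norm f)\<^sup>2)"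
    by (simp only: integral_gauss_fourier[OF f \<sigma>])
  then have lim: "(\<lambda>n. LINT \<xi>|lborel. gauss_weight (\<sigma> n) \<xi> * (cmod (fourier_integral f \<xi>))\<^sup>2) \<longlonglongrightarrow> (L2_norm f)\<^sup>2"
    by (simp only: tendsto_of_real_iff)
  \<comment> \<open>Since \<open>\<sigma> n\<close> decreases, the weights increase. Monotone rather
    than dominated convergence is the right tool because it also delivers the integrability of the
    limit.\<close>
  have mono: "gauss_weight (\<sigma> m) \<xi> \<le> gauss_weight (\<sigma> n) \<xi>" if "m \<le> n" for m n and \<xi> :: 'a
    using that by (auto simp: gauss_weight_def \<sigma>_def frac_le intro!: power_mono mult_right_mono divide_right_mono)
  have "(\<lambda>n. gauss_weight (\<sigma> n) \<xi> * (cmod (fourier_integral f \<xi>))\<^sup>2) \<longlonglongrightarrow> (cmod (fourier_integral f \<xi>))\<^sup>2" for \<xi>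
    unfolding gauss_weight_def by (auto intro!: tendsto_eq_intros \<sigma>0)
  then have "has_bochner_integral lborel (\<lambda>\<xi>. (cmod (fourier_integral f \<xi>))\<^sup>2) ((L2_norm f)\<^sup>2)"
    using integrable_gauss_fourier[OF f \<sigma>] lim
    by (intro has_bochner_integral_monotone_convergence[where f="\<lambda>n \<xi>. gauss_weight (\<sigma> n) \<xi> * (cmod (fourier_integral f \<xi>))\<^sup>2"])
      (auto simp: mono_def intro!: mult_right_mono mono)
  then have "integrable lborel (\<lambda>\<xi>. (cmod (fourier_integral f \<xi>))\<^sup>2)"
    "(LINT \<xi>|lborel. (cmod (fourier_integral f \<xi>))\<^sup>2) = (L2_norm f)\<^sup>2"
    by (auto simp: has_bochner_integral_iff)
  then show "fourier_integral f \<in> L2_space" and "L2_norm (fourier_integral f) = L2_norm f"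
    by (auto intro!: L2_spaceI simp: L2_norm_def[of "fourier_integral f"])
qed

subsection \<open>The Fourier transform as a unitary relation\<close>

lemma L2_norm_diff_power2:
  assumes f: "f \<in> L2_space" and g: "g \<in> L2_space"
  shows "(L2_norm (\<lambda>x. f x - g x))\<^sup>2 = (L2_norm f)\<^sup>2 + (L2_norm g)\<^sup>2 - 2 * Re (LINT x|lborel. f x * cnj (g x))"
proof -
  have "(cmod (a - b))\<^sup>2 = (cmod a)\<^sup>2 + (cmod b)\<^sup>2 - 2 * Re (a * cnj b)" for a b
    by (simp only: cmod_power2) (simp add: power2_eq_square algebra_simps)
  then have "(L2_norm (\<lambda>x. f x - g x))\<^sup>2
      = (LINT x|lborel. (cmod (f x))\<^sup>2 + (cmod (g x))\<^sup>2 - 2 * Re (f x * cnj (g x)))"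
    by (simp add: L2_norm_power2)
  also have "\<dots> = (LINT x|lborel. (cmod (f x))\<^sup>2) + (LINT x|lborel. (cmod (g x))\<^sup>2)
      - 2 * Re (LINT x|lborel. f x * cnj (g x))"
    using L2_space_integrable[OF f] L2_space_integrable[OF g] L2_integrable_mult_cnj[OF f g]
    by (simp del: times_complex.sel)
  finally show ?thesis by (simp add: L2_norm_power2)
qed

lemma L2_tendsto_indicator_cball:
  fixes f :: "'a::euclidean_space \<Rightarrow> complex"
  assumes f: "f \<in> L2_space"
  shows "L2_tendsto (\<lambda>n x. indicator (cball 0 (real n)) x * f x) f"
proof -
  note [measurable] = L2_space_measurable[OF f]
  have "(\<lambda>n. LINT x|lborel. (cmod (indicator (cball 0 (real n)) x * f x - f x))\<^sup>2) \<longlonglongrightarrow> (LINT x::'a|lborel. 0)"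
  proof (rule integral_dominated_convergence[where w="\<lambda>x. (cmod (f x))\<^sup>2"])
    show "AE x in lborel. (\<lambda>n. (cmod (indicator (cball 0 (real n)) x * f x - f x))\<^sup>2) \<longlonglongrightarrow> 0"
    proof (intro AE_I2 tendsto_eventually)
      fix x :: 'a
      have "\<forall>\<^sub>F n in sequentially. norm x \<le> real n"
        by (meson eventually_sequentiallyI nat_ceiling_le_eq)
      then show "\<forall>\<^sub>F n in sequentially. (cmod (indicator (cball 0 (real n)) x * f x - f x))\<^sup>2 = 0"
        by eventually_elim simp
    qed
  qed (use L2_space_integrable[OF f] in \<open>auto simp: indicator_def\<close>)
  then have "(\<lambda>n. sqrt (LINT x|lborel. (cmod (indicator (cball 0 (real n)) x * f x - f x))\<^sup>2)) \<longlonglongrightarrow> 0"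
    using tendsto_real_sqrt by fastforce
  then show ?thesis
    using f by (auto simp: L2_tendsto_def L2_norm_def intro!: L2_space_indicator_mult)
qed

lemma L2_tendstoD:
  assumes "L2_tendsto \<phi> f" "e > 0"
  obtains n where "L2_norm (\<lambda>x. \<phi> n x - f x) < e"
proof -
  have "\<forall>\<^sub>F n in sequentially. L2_norm (\<lambda>x. \<phi> n x - f x) < e"
    using assms by (auto simp: L2_tendsto_def intro: order_tendstoD(2))
  then show thesis
    using that by (auto simp: eventually_sequentially)
qed

lemma L2_space_cnj: "f \<in> L2_space \<Longrightarrow> (\<lambda>x. cnj (f x)) \<in> L2_space"
  by (auto simp: L2_space_def)

text \<open>
  The truncated inverse transforms of \<open>G\<close> do the job: by Plancherel and the multiplication formula
  the squared distance to \<open>G\<close> is the \<open>L\<^sup>2\<close> mass lost in the truncation.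
\<close>

lemma fourier_integral_dense_L1:
  fixes G :: "'a::euclidean_space \<Rightarrow> complex"
  assumes G: "integrable lborel G" "G \<in> L2_space" and e: "e > 0"
  obtains \<phi> where "integrable lborel \<phi>" "\<phi> \<in> L2_space" "L2_norm (\<lambda>\<xi>. fourier_integral \<phi> \<xi> - G \<xi>) < e"
proof -
  \<comment> \<open>The function \<open>cnj (k x)\<close> is the inverse Fourier integral of
    \<open>G\<close> at \<open>x\<close>, so the results for the forward transform also cover the
    inverse one.\<close>
  define k where "k = fourier_integral (\<lambda>x. cnj (G x))"
  have cnjG: "integrable lborel (\<lambda>x. cnj (G x))" "(\<lambda>x. cnj (G x)) \<in> L2_space"
    using G by (auto intro: L2_space_cnj)
  have k: "k \<in> L2_space" "L2_norm k = L2_norm G"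
    using Plancherel[OF cnjG] by (auto simp: k_def L2_norm_def)
  note [measurable] = L2_space_measurable[OF k(1)]
  define \<phi> where "\<phi> n x = indicator (cball 0 (real n)) x * cnj (k x)" for n x
  have \<phi>2: "L2_tendsto \<phi> (\<lambda>x. cnj (k x))"
    unfolding \<phi>_def[abs_def] by (intro L2_tendsto_indicator_cball L2_space_cnj k)
  then have \<phi>: "\<phi> n \<in> L2_space" for n
    by (simp add: L2_tendsto_def)
  have int: "integrable lborel (\<phi> n)" for n
  proof (rule Bochner_Integration.integrable_bound)
    \<comment> \<open>The \<open>L\<^sup>1\<close> norm of \<open>G\<close> bounds \<open>k\<close>
      uniformly; hence \<open>k\<close> is integrable on every ball, which is what the truncation is
      for.\<close>
    let ?C = "LINT x|lborel. cmod (cnj (G x))"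
    show "integrable lborel (\<lambda>x::'a. indicator (cball 0 (real n)) x * ?C)"
      using emeasure_lborel_cball_finite[of "0::'a" "real n"]
      by (intro integrable_mult_left) (simp add: integrable_indicator_iff)
    show "AE x in lborel. norm (\<phi> n x) \<le> norm (indicator (cball 0 (real n)) x * ?C)"
      using cmod_fourier_integral_le[of "\<lambda>x. cnj (G x)"]
      by (intro AE_I2) (auto simp: \<phi>_def k_def indicator_def intro: order_trans[OF _ abs_ge_self])
    show "\<phi> n \<in> borel_measurable lborel"
      using L2_space_measurable[OF \<phi>] by simp
  qed
  have dist: "(L2_norm (\<lambda>\<xi>. fourier_integral (\<phi> n) \<xi> - G \<xi>))\<^sup>2 = (L2_norm k)\<^sup>2 - (L2_norm (\<phi> n))\<^sup>2" for n
  proof -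
    \<comment> \<open>Moving the transform onto \<open>cnj G\<close> produces \<open>k\<close>, and
      on the ball \<open>\<phi> n\<close> is its conjugate; so the inner product equals the squared
      norm of \<open>\<phi> n\<close>.\<close>
    have "(LINT \<xi>|lborel. fourier_integral (\<phi> n) \<xi> * cnj (G \<xi>)) = (LINT x|lborel. \<phi> n x * k x)"
      unfolding k_def by (rule integral_fourier_integral_mult[OF int cnjG(1)])
    also have "\<dots> = (LINT x|lborel. complex_of_real ((cmod (\<phi> n x))\<^sup>2))"
      by (intro Bochner_Integration.integral_cong refl)
        (auto simp: \<phi>_def indicator_def complex_norm_square mult.commute simp del: of_real_power)
    also have "\<dots> = complex_of_real ((L2_norm (\<phi> n))\<^sup>2)"
      by (simp add: L2_norm_power2 del: of_real_power)
    finally show ?thesis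
      using L2_norm_diff_power2[OF Plancherel(1)[OF int \<phi>] G(2), of n] Plancherel(2)[OF int \<phi>, of n] k(2)
      by (simp del: of_real_power)
  qed
  have "L2_norm (\<lambda>x. cnj (k x)) = L2_norm k"
    by (simp add: L2_norm_def)
  then have "(\<lambda>n. (L2_norm k)\<^sup>2 - (L2_norm (\<phi> n))\<^sup>2) \<longlonglongrightarrow> 0"
    using L2_tendsto_imp_norm[OF \<phi>2] by (auto intro!: tendsto_eq_intros)
  then have "\<forall>\<^sub>F n in sequentially. (L2_norm k)\<^sup>2 - (L2_norm (\<phi> n))\<^sup>2 < e\<^sup>2"
    using e by (intro order_tendstoD(2)) auto
  then obtain n where "(L2_norm k)\<^sup>2 - (L2_norm (\<phi> n))\<^sup>2 < e\<^sup>2"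
    by (auto simp: eventually_sequentially)
  then have "L2_norm (\<lambda>\<xi>. fourier_integral (\<phi> n) \<xi> - G \<xi>) < e"
    using e by (intro power2_less_imp_less[of _ e]) (auto simp: dist)
  then show thesis
    using that int \<phi> by blast
qed

text \<open>A truncation of \<open>G\<close> to a ball is integrable by Cauchy-Schwarz against the
  indicator of the ball, which reduces to the integrable case at a cost of
  \<open>e/2\<close>.\<close>

lemma fourier_integral_dense:
  fixes G :: "'a::euclidean_space \<Rightarrow> complex"
  assumes G: "G \<in> L2_space" and e: "e > 0"
  obtains \<phi> where "integrable lborel \<phi>" "\<phi> \<in> L2_space" "L2_norm (\<lambda>\<xi>. fourier_integral \<phi> \<xi> - G \<xi>) < e"
proof -
  obtain n where n: "L2_norm (\<lambda>x. indicator (cball 0 (real n)) x * G x - G x) < e / 2"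
    using L2_tendstoD[OF L2_tendsto_indicator_cball[OF G], of "e/2"] e by auto
  define H where "H x = indicator (cball 0 (real n)) x * G x" for x
  have H: "H \<in> L2_space"
    unfolding H_def[abs_def] by (rule L2_space_indicator_mult[OF G]) simp
  have "(indicator (cball 0 (real n)) :: 'a \<Rightarrow> complex) \<in> L2_space"
    using emeasure_lborel_cball_finite[of "0::'a" "real n"] by (intro L2_space_indicator) auto
  from L2_integrable_mult_norm[OF this G] have "integrable lborel H"
    by (rule Bochner_Integration.integrable_bound)
      (use L2_space_measurable[OF H] in \<open>auto simp: H_def norm_mult\<close>)
  from fourier_integral_dense_L1[OF this H, of "e/2"] e
  obtain \<phi> where \<phi>: "integrable lborel \<phi>" "\<phi> \<in> L2_space" "L2_norm (\<lambda>\<xi>. fourier_integral \<phi> \<xi> - H \<xi>) < e/2"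
    by auto
  then have "L2_norm (\<lambda>\<xi>. fourier_integral \<phi> \<xi> - G \<xi>) < e"
    using L2_dist_triangle[OF Plancherel(1)[OF \<phi>(1,2)] H G] n by (simp add: H_def)
  then show thesis
    using that \<phi> by blast
qed

section \<open>Isometry, uniqueness and surjectivity of the extended transform\<close>

lemma L2_norm_fourier_integral_diff:
  assumes "integrable lborel f" "f \<in> L2_space" "integrable lborel g" "g \<in> L2_space"
  shows "L2_norm (\<lambda>\<xi>. fourier_integral f \<xi> - fourier_integral g \<xi>) = L2_norm (\<lambda>x. f x - g x)"
proof -
  have "L2_norm (fourier_integral (\<lambda>x. f x - g x)) = L2_norm (\<lambda>x. f x - g x)"
    using assms by (intro Plancherel L2_space_diff) auto
  moreover have "fourier_integral (\<lambda>x. f x - g x) = (\<lambda>\<xi>. fourier_integral f \<xi> - fourier_integral g \<xi>)"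
    using assms by (intro ext fourier_integral_diff)
  ultimately show ?thesis by simp
qed

lemma has_L2_fourier_fourier_integral:
  assumes "integrable lborel f" "f \<in> L2_space"
  shows "has_L2_fourier f (fourier_integral f)"
  unfolding has_L2_fourier_def
  by (rule exI[of _ "\<lambda>_. f"])
    (use assms Plancherel[OF assms] in \<open>auto simp: L2_tendsto_def L2_norm_def\<close>)

lemma has_L2_fourier_norm:
  assumes "has_L2_fourier f F"
  shows "L2_norm f = L2_norm F"
proof -
  obtain \<phi> where \<phi>: "\<And>n. integrable lborel (\<phi> n)" "L2_tendsto \<phi> f" "L2_tendsto (\<lambda>n. fourier_integral (\<phi> n)) F"
    using assms by (auto simp: has_L2_fourier_def)
  then have "L2_norm (fourier_integral (\<phi> n)) = L2_norm (\<phi> n)" for n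
    by (intro Plancherel) (auto simp: L2_tendsto_def)
  then show ?thesis
    using L2_tendsto_imp_norm[OF \<phi>(2)] L2_tendsto_imp_norm[OF \<phi>(3)] LIMSEQ_unique by auto
qed

text \<open>Two sequences approximating \<open>f\<close> approach each other, and by isometry so do
  their transforms.\<close>

lemma has_L2_fourier_unique_AE:
  assumes "has_L2_fourier f F" "has_L2_fourier f G"
  shows "AE \<xi> in lborel. F \<xi> = G \<xi>"
proof -
  obtain \<phi> where \<phi>: "\<And>n. integrable lborel (\<phi> n)" "L2_tendsto \<phi> f" "L2_tendsto (\<lambda>n. fourier_integral (\<phi> n)) F"
    using assms(1) by (auto simp: has_L2_fourier_def)
  obtain \<psi> where \<psi>: "\<And>n. integrable lborel (\<psi> n)" "L2_tendsto \<psi> f" "L2_tendsto (\<lambda>n. fourier_integral (\<psi> n)) G"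
    using assms(2) by (auto simp: has_L2_fourier_def)
  have L2: "\<phi> n \<in> L2_space" "\<psi> n \<in> L2_space" "f \<in> L2_space" for n
    using \<phi>(2) \<psi>(2) by (auto simp: L2_tendsto_def)
  have "(\<lambda>n. L2_norm (\<lambda>x. \<phi> n x - f x) + L2_norm (\<lambda>x. \<psi> n x - f x)) \<longlonglongrightarrow> 0"
    using \<phi>(2) \<psi>(2) by (auto simp: L2_tendsto_def intro!: tendsto_eq_intros)
  moreover have "L2_norm (\<lambda>\<xi>. fourier_integral (\<phi> n) \<xi> - fourier_integral (\<psi> n) \<xi>)
      \<le> L2_norm (\<lambda>x. \<phi> n x - f x) + L2_norm (\<lambda>x. \<psi> n x - f x)" for n
    using L2_dist_triangle[OF L2(1) L2(3) L2(2), of n n] L2_norm_minus_commute[of f "\<psi> n"]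
    by (simp add: L2_norm_fourier_integral_diff[OF \<phi>(1) L2(1) \<psi>(1) L2(2)])
  ultimately have "(\<lambda>n. L2_norm (\<lambda>\<xi>. fourier_integral (\<phi> n) \<xi> - fourier_integral (\<psi> n) \<xi>)) \<longlonglongrightarrow> 0"
    by (elim Lim_null_comparison[OF always_eventually, OF allI, rotated]) simp_all
  then show ?thesis
    by (rule L2_tendsto_unique_AE[OF \<phi>(3) \<psi>(3)])
qed

text \<open>Agreement almost everywhere does not transfer Borel measurability, so membership of
  \<open>G\<close> in \<open>L2_space\<close> is asked for separately.\<close>

lemma has_L2_fourier_cong_AE:
  assumes "has_L2_fourier f F" "G \<in> L2_space" "AE \<xi> in lborel. F \<xi> = G \<xi>"
  shows "has_L2_fourier f G"
proof -
  obtain \<phi> where \<phi>: "\<And>n. integrable lborel (\<phi> n)" "L2_tendsto \<phi> f" "L2_tendsto (\<lambda>n. fourier_integral (\<phi> n)) F"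
    using assms(1) by (auto simp: has_L2_fourier_def)
  have "L2_norm (\<lambda>\<xi>. fourier_integral (\<phi> n) \<xi> - F \<xi>) = L2_norm (\<lambda>\<xi>. fourier_integral (\<phi> n) \<xi> - G \<xi>)" for n
    using \<phi>(3) assms(2,3) by (intro L2_norm_cong_AE L2_space_diff) (auto simp: L2_tendsto_def)
  then have "L2_tendsto (\<lambda>n. fourier_integral (\<phi> n)) G"
    using \<phi>(3) assms(2) by (simp add: L2_tendsto_def)
  with \<phi>(1,2) show ?thesis
    by (auto simp: has_L2_fourier_def)
qed

text \<open>The range is dense, and closed because the transform is an isometry on a complete space:
  approximants of \<open>G\<close> with geometric errors have preimages with geometric steps, and
  these converge.\<close>

lemma has_L2_fourier_surj:
  fixes G :: "'a::euclidean_space \<Rightarrow> complex"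
  assumes G: "G \<in> L2_space"
  obtains g where "has_L2_fourier g G"
proof -
  \<comment> \<open>The extra factor \<open>1/2\<close> lets the errors at \<open>n\<close> and
    \<open>Suc n\<close> together stay below \<open>(1/2)^n\<close>, the rate that
    \<open>L2_complete_fast\<close> expects.\<close>
  have "\<exists>\<phi>. integrable lborel \<phi> \<and> \<phi> \<in> L2_space \<and> L2_norm (\<lambda>\<xi>. fourier_integral \<phi> \<xi> - G \<xi>) < (1/2)^n / 2" for n
    using fourier_integral_dense[OF G, of "(1/2)^n / 2"] by (metis half_gt_zero zero_less_divide_1_iff zero_less_numeral zero_less_power)
  then obtain \<phi> where \<phi>: "\<And>n. integrable lborel (\<phi> n)" "\<And>n. \<phi> n \<in> L2_space"
      "\<And>n. L2_norm (\<lambda>\<xi>. fourier_integral (\<phi> n) \<xi> - G \<xi>) < (1/2)^n / 2"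
    by metis
  note F = Plancherel(1)[OF \<phi>(1,2)]
  have "L2_norm (\<lambda>x. \<phi> (Suc n) x - \<phi> n x) \<le> (1/2)^n" for n
  proof -
    have "L2_norm (\<lambda>x. \<phi> (Suc n) x - \<phi> n x)
        \<le> L2_norm (\<lambda>\<xi>. fourier_integral (\<phi> (Suc n)) \<xi> - G \<xi>) + L2_norm (\<lambda>\<xi>. fourier_integral (\<phi> n) \<xi> - G \<xi>)"
      using L2_dist_triangle[OF F G F, of "Suc n" n] L2_norm_minus_commute[of G "fourier_integral (\<phi> n)"]
      by (simp add: L2_norm_fourier_integral_diff[OF \<phi>(1,2) \<phi>(1,2)])
    also have "\<dots> \<le> (1/2)^Suc n / 2 + (1/2)^n / 2"
      by (intro add_mono less_imp_le \<phi>(3))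
    also have "\<dots> \<le> (1/2)^n" by simp
    finally show ?thesis .
  qed
  then obtain g where g: "L2_tendsto \<phi> g"
    using L2_complete_fast[of \<phi>] \<phi>(2) by blast
  have "(\<lambda>n. (1/2::real)^n / 2) \<longlonglongrightarrow> 0"
    by (intro tendsto_divide_zero LIMSEQ_power_zero) simp
  then have "(\<lambda>n. L2_norm (\<lambda>\<xi>. fourier_integral (\<phi> n) \<xi> - G \<xi>)) \<longlonglongrightarrow> 0"
    by (rule Lim_null_comparison[OF always_eventually, OF allI, rotated])
      (simp only: real_norm_def abs_of_nonneg[OF L2_norm_nonneg] less_imp_le[OF \<phi>(3)])
  then have "L2_tendsto (\<lambda>n. fourier_integral (\<phi> n)) G"
    using F G by (simp add: L2_tendsto_def)
  with \<phi>(1) g have "has_L2_fourier g G"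
    by (auto simp: has_L2_fourier_def)
  then show thesis by (rule that)
qed

text \<open>Surjectivity provides a candidate for the choice operator. The chosen function may
  belong to another transform \<open>F'\<close> of \<open>f\<close>, which agrees with
  \<open>F\<close> almost everywhere.\<close>

lemma has_L2_fourier_fourier_projection:
  fixes f :: "'a::euclidean_space \<Rightarrow> complex"
  assumes f: "has_L2_fourier f F" and S: "S \<in> sets borel"
  shows "has_L2_fourier (fourier_projection S f) (\<lambda>\<xi>. indicator S \<xi> * F \<xi>)"
proof -
  have L2: "(\<lambda>\<xi>. indicator S \<xi> * F \<xi>) \<in> L2_space"
    using f S by (auto simp: has_L2_fourier_def L2_tendsto_def intro: L2_space_indicator_mult)
  obtain g where "has_L2_fourier g (\<lambda>\<xi>. indicator S \<xi> * F \<xi>)"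
    using has_L2_fourier_surj[OF L2] by blast
  with f have "\<exists>g F. has_L2_fourier f F \<and> has_L2_fourier g (\<lambda>\<xi>. indicator S \<xi> * F \<xi>)"
    by blast
  from someI_ex[OF this] obtain F' where F': "has_L2_fourier f F'"
      "has_L2_fourier (fourier_projection S f) (\<lambda>\<xi>. indicator S \<xi> * F' \<xi>)"
    unfolding fourier_projection_def by blast
  have "AE \<xi> in lborel. indicator S \<xi> * F' \<xi> = indicator S \<xi> * F \<xi>"
    using has_L2_fourier_unique_AE[OF F'(1) f] by eventually_elim simp
  then show ?thesis
    by (rule has_L2_fourier_cong_AE[OF F'(2) L2])
qed

subsection \<open>The diagonal strip\<close>

text \<open>The first bound is the \<open>L\<^sup>1\<close> norm of the indicator. The second comes
  from the explicit antiderivative of the phase, of modulus \<open>1 / (2 * pi * \<eta>)\<close> at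
  either endpoint.\<close>

lemma
  assumes "a \<le> b"
  shows cmod_fourier_integral_interval_le_length:
      "cmod (fourier_integral (indicator {a<..<b::real}) \<eta>) \<le> b - a"
    and cmod_fourier_integral_interval_le_inverse:
      "\<eta> > 0 \<Longrightarrow> cmod (fourier_integral (indicator {a<..<b::real}) \<eta>) \<le> 1 / \<eta>"
proof -
  have "(LINT x|lborel. cmod (indicator {a<..<b} x)) = (LINT x|lborel. indicator {a<..<b} x)"
    by (intro Bochner_Integration.integral_cong) (auto simp: indicator_def)
  then show "cmod (fourier_integral (indicator {a<..<b}) \<eta>) \<le> b - a"
    using cmod_fourier_integral_le[of "indicator {a<..<b}" \<eta>] assms by simp
next
  assume \<eta>: "\<eta> > 0"
  define \<kappa> where "\<kappa> = - 2 * complex_of_real pi * \<i> * complex_of_real \<eta>"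
  have \<kappa>: "\<kappa> \<noteq> 0" "cmod \<kappa> = 2 * pi * \<eta>"
    using \<eta> by (auto simp: \<kappa>_def norm_mult)
  define F where "F x = exp (complex_of_real x * \<kappa>) / \<kappa>" for x
  have cis_eq: "cis (- 2 * pi * (x * \<eta>)) = exp (complex_of_real x * \<kappa>)" for x
    by (simp add: cis_conv_exp \<kappa>_def mult_ac)
  then have cmod_exp: "cmod (exp (complex_of_real x * \<kappa>)) = 1" for x
    by (metis norm_cis)
  have "has_bochner_integral lborel (\<lambda>x. indicator {a .. b} x *\<^sub>R cis (- 2 * pi * (x * \<eta>))) (F b - F a)"
  proof (rule has_bochner_integral_FTC_Icc[OF assms])
    fix x
    have "((\<lambda>z. exp (z * \<kappa>) / \<kappa>) has_field_derivative exp (complex_of_real x * \<kappa>)) (at (complex_of_real x))"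
      using \<kappa>(1) by (auto intro!: derivative_eq_intros)
    then show "(F has_vector_derivative cis (- 2 * pi * (x * \<eta>))) (at x within {a..b})"
      unfolding F_def cis_eq by (rule has_vector_derivative_real_field)
  qed (auto intro!: continuous_intros)
  then have "F b - F a = (LINT x|lborel. indicator {a .. b} x *\<^sub>R cis (- 2 * pi * (x * \<eta>)))"
    by (simp add: has_bochner_integral_iff)
  also have "\<dots> = fourier_integral (indicator {a<..<b}) \<eta>"
    unfolding fourier_integral_def
  \<comment> \<open>The fundamental theorem is applied on the closed interval; the endpoints form a
    null set.\<close>
  proof (rule integral_cong_AE)
    show "AE x in lborel. indicator {a..b} x *\<^sub>R cis (- 2 * pi * (x * \<eta>))
        = cis (- 2 * pi * (x \<bullet> \<eta>)) * indicator {a<..<b} x"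
      using AE_lborel_singleton[of a] AE_lborel_singleton[of b]
      by eventually_elim (auto simp: indicator_def)
  qed measurable
  finally have "cmod (fourier_integral (indicator {a<..<b}) \<eta>) \<le> cmod (F b) + cmod (F a)"
    by (metis norm_triangle_ineq4)
  also have "\<dots> = 1 / (pi * \<eta>)"
    using \<eta> by (simp add: F_def norm_divide cmod_exp \<kappa>(2) del: norm_exp_eq_Re)
  also have "\<dots> \<le> 1 / \<eta>"
    using \<eta> pi_ge_two by (simp add: frac_le)
  finally show "cmod (fourier_integral (indicator {a<..<b}) \<eta>) \<le> 1 / \<eta>" .
qed

definition diagonal_strip :: "real \<Rightarrow> (real \<times> real) set" where
  "diagonal_strip w = {p. 0 < fst p \<and> fst p < 1 \<and> \<bar>snd p - fst p\<bar> < w}"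

lemma open_diagonal_strip: "open (diagonal_strip w)"
  unfolding diagonal_strip_def
  by (intro open_Collect_conj open_Collect_less continuous_intros)

lemma indicator_diagonal_strip:
  "indicator (diagonal_strip w) (x, y) = indicator {0<..<1} x * (indicator {-w<..<w} (y - x) :: 'a::semiring_1)"
  by (auto simp: diagonal_strip_def indicator_def)

lemma emeasure_diagonal_strip:
  assumes "w > 0"
  shows "emeasure lborel (diagonal_strip w) = ennreal (2 * w)"
proof -
  have [measurable]: "diagonal_strip w \<in> sets borel"
    using open_diagonal_strip by (rule borel_open)
  have "emeasure lborel (diagonal_strip w) = emeasure (lborel \<Otimes>\<^sub>M lborel) (diagonal_strip w)"
    by (simp add: lborel_prod)
  also have "\<dots> = (\<integral>\<^sup>+x. emeasure lborel (Pair x -` diagonal_strip w) \<partial>lborel)"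
    by (rule lborel.emeasure_pair_measure_alt) (unfold lborel_prod, simp)
  also have "\<dots> = (\<integral>\<^sup>+x. ennreal (2 * w) * indicator {0<..<1::real} x \<partial>lborel)"
  proof (intro nn_integral_cong)
    fix x :: real
    have "Pair x -` diagonal_strip w = (if x \<in> {0<..<1} then {x - w<..<x + w} else {})"
      by (auto simp: diagonal_strip_def)
    then show "emeasure lborel (Pair x -` diagonal_strip w) = ennreal (2 * w) * indicator {0<..<1::real} x"
      using assms by simp
  qed
  also have "\<dots> = ennreal (2 * w)"
    by (subst nn_integral_cmult_indicator) auto
  finally show ?thesis .
qed

text \<open>The shear \<open>y = x + t\<close> turns the strip into a rectangle and the phase into
  \<open>x * (\<xi> + \<eta>) + t * \<eta>\<close>, so the two variables separate.\<close>

lemma fourier_integral_diagonal_strip: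
  assumes "w > 0"
  shows "fourier_integral (indicator (diagonal_strip w)) (\<xi>, \<eta>)
    = fourier_integral (indicator {0<..<1::real}) (\<xi> + \<eta>) * fourier_integral (indicator {-w<..<w}) \<eta>"
proof -
  let ?S = "fourier_integral (indicator {-w<..<w}) \<eta>"
  have [measurable]: "diagonal_strip w \<in> sets borel"
    using open_diagonal_strip by (rule borel_open)
  have "integrable lborel (indicator (diagonal_strip w) :: real \<times> real \<Rightarrow> complex)"
    using emeasure_diagonal_strip[OF assms] by (intro integrable_indicator_lborel) auto
  then have int: "integrable (lborel \<Otimes>\<^sub>M lborel) (\<lambda>p. cis (- 2 * pi * (p \<bullet> (\<xi>, \<eta>))) * indicator (diagonal_strip w) p)"
    unfolding lborel_prod by (rule integrable_cis_mult) measurable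
  have "fourier_integral (indicator (diagonal_strip w)) (\<xi>, \<eta>)
      = (LINT x|lborel. (LINT y|lborel. cis (- 2 * pi * (x * \<xi> + y * \<eta>)) * (indicator {0<..<1} x * indicator {-w<..<w} (y - x))))"
    using lborel_pair.integral_fst'[OF int]
    by (simp add: fourier_integral_def lborel_prod inner_prod_def indicator_diagonal_strip)
  also have "\<dots> = (LINT x|lborel. cis (- 2 * pi * (x * (\<xi> + \<eta>))) * indicator {0<..<1} x * ?S)"
  proof (intro Bochner_Integration.integral_cong refl)
    fix x
    let ?f = "\<lambda>y. cis (- 2 * pi * (x * \<xi> + y * \<eta>)) * (indicator {0<..<1} x * indicator {-w<..<w} (y - x))"
    have "(LINT y|lborel. ?f y) = (LINT t|lborel. ?f (x + t))"
      by (rule integral_lborel_translate[symmetric]) measurable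
    also have "\<dots> = (LINT t|lborel. (cis (- 2 * pi * (x * (\<xi> + \<eta>))) * indicator {0<..<1} x) * (cis (- 2 * pi * (t * \<eta>)) * indicator {-w<..<w} t))"
    proof (intro Bochner_Integration.integral_cong refl)
      fix t
      have "cis (- 2 * pi * (x * \<xi> + (x + t) * \<eta>)) = cis (- 2 * pi * (x * (\<xi> + \<eta>))) * cis (- 2 * pi * (t * \<eta>))"
        by (simp add: cis_mult algebra_simps)
      then show "?f (x + t) = (cis (- 2 * pi * (x * (\<xi> + \<eta>))) * indicator {0<..<1} x) * (cis (- 2 * pi * (t * \<eta>)) * indicator {-w<..<w} t)"
        by (simp add: mult_ac)
    qed
    also have "\<dots> = cis (- 2 * pi * (x * (\<xi> + \<eta>))) * indicator {0<..<1} x * ?S"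
      by (subst integral_mult_right_zero) (simp add: fourier_integral_def)
    finally show "(LINT y|lborel. ?f y) = cis (- 2 * pi * (x * (\<xi> + \<eta>))) * indicator {0<..<1} x * ?S" .
  qed
  also have "\<dots> = fourier_integral (indicator {0<..<1::real}) (\<xi> + \<eta>) * ?S"
    by (subst integral_mult_left_zero) (simp add: fourier_integral_def)
  finally show ?thesis .
qed

section \<open>Domination on the first quadrant\<close>

definition quadrant_majorant :: "real \<times> real \<Rightarrow> real" where
  "quadrant_majorant p = indicator {0..} (fst p) * (indicator {0..} (snd p) * (8 / ((1 + fst p + snd p)\<^sup>2 * (1 + snd p))))"

lemma DERIV_minus_divide_add:
  fixes a c x :: real
  assumes "c + x \<noteq> 0"
  shows "DERIV (\<lambda>x. - (a / (c + x))) x :> a / (c + x)\<^sup>2"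
  using assms by (auto intro!: derivative_eq_intros simp: power2_eq_square)

text \<open>Tonelli with the first coordinate innermost: that integral is
  \<open>8 / (1 + y)\<^sup>2\<close>, which has the finite integral 8 over the half-line. Both
  antiderivatives are of the form treated in \<open>DERIV_minus_divide_add\<close>.\<close>

lemma integrable_quadrant_majorant: "integrable lborel quadrant_majorant"
proof (rule integrableI_nonneg)
  have "quadrant_majorant \<in> borel_measurable (borel \<Otimes>\<^sub>M borel)"
    unfolding quadrant_majorant_def by measurable
  then show [measurable]: "quadrant_majorant \<in> borel_measurable lborel"
    by (simp add: borel_prod)
  show "AE p in lborel. 0 \<le> quadrant_majorant p"
    by (intro AE_I2) (auto simp: quadrant_majorant_def indicator_def)
  have inner: "(\<integral>\<^sup>+x. ennreal (quadrant_majorant (x, y)) \<partial>lborel) = ennreal (8 / (1 + y)\<^sup>2) * indicator {0..} y" for y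
  proof (cases "y \<ge> 0")
    case True
    have "(\<integral>\<^sup>+x. ennreal (8 / (1 + y) / (1 + y + x)\<^sup>2) * indicator {0..} x \<partial>lborel)
        = ennreal (0 - - (8 / (1 + y) / (1 + y + 0)))"
    proof (rule nn_integral_FTC_atLeast)
      fix x :: real assume "0 \<le> x"
      then show "DERIV (\<lambda>x. - (8 / (1 + y) / (1 + y + x))) x :> 8 / (1 + y) / (1 + y + x)\<^sup>2"
        using True by (intro DERIV_minus_divide_add) simp
      show "0 \<le> 8 / (1 + y) / (1 + y + x)\<^sup>2"
        using True by simp
    next
      show "((\<lambda>x. - (8 / (1 + y) / (1 + y + x))) \<longlongrightarrow> 0) at_top"
        by real_asymp
    qed measurable
    also have "(\<integral>\<^sup>+x. ennreal (8 / (1 + y) / (1 + y + x)\<^sup>2) * indicator {0..} x \<partial>lborel)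
        = (\<integral>\<^sup>+x. ennreal (quadrant_majorant (x, y)) \<partial>lborel)"
      using True by (intro nn_integral_cong) (auto simp: quadrant_majorant_def indicator_def add_ac mult_ac)
    finally show ?thesis
      using True by (simp add: power2_eq_square)
  qed (simp add: quadrant_majorant_def)
  have "(\<integral>\<^sup>+p. ennreal (quadrant_majorant p) \<partial>lborel) = (\<integral>\<^sup>+y. (\<integral>\<^sup>+x. ennreal (quadrant_majorant (x, y)) \<partial>lborel) \<partial>lborel)"
    by (subst lborel_pair.nn_integral_snd) (auto simp: lborel_prod)
  also have "\<dots> = (\<integral>\<^sup>+y. ennreal (8 / (1 + y)\<^sup>2) * indicator {0..} y \<partial>lborel)"
    by (simp only: inner)
  also have "\<dots> = ennreal (0 - - (8 / (1 + 0)))"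
  proof (rule nn_integral_FTC_atLeast)
    fix y :: real assume "0 \<le> y"
    then show "DERIV (\<lambda>y. - (8 / (1 + y))) y :> 8 / (1 + y)\<^sup>2"
      by (intro DERIV_minus_divide_add) simp
  next
    show "((\<lambda>y::real. - (8 / (1 + y))) \<longlongrightarrow> 0) at_top"
      by real_asymp
  qed auto
  also have "\<dots> < \<infinity>" by simp
  finally show "(\<integral>\<^sup>+p. ennreal (quadrant_majorant p) \<partial>lborel) < \<infinity>" .
qed

text \<open>The divisor \<open>2 * w\<close> is the area of the strip. One of the two factors
  \<open>S\<close> cancels it through \<open>S \<le> 2 * w\<close>; the other either yields decay in
  \<eta>, for a majorant independent of \<open>w\<close>, or is again bounded by
  \<open>2 * w\<close>, for the pointwise limit.\<close>

lemma cmod_fourier_strip_le: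
  assumes w: "w > 0" "2 * w \<le> 1" and pos: "\<xi> > 0" "\<eta> > 0"
  shows "(cmod (fourier_integral (indicator (diagonal_strip w)) (\<xi>, \<eta>)))\<^sup>2 / (2 * w) \<le> quadrant_majorant (\<xi>, \<eta>)"
    and "(cmod (fourier_integral (indicator (diagonal_strip w)) (\<xi>, \<eta>)))\<^sup>2 / (2 * w) \<le> 2 * w"
proof -
  define D S where "D = cmod (fourier_integral (indicator {0<..<1::real}) (\<xi> + \<eta>))"
    and "S = cmod (fourier_integral (indicator {-w<..<w}) \<eta>)"
  have eq: "(cmod (fourier_integral (indicator (diagonal_strip w)) (\<xi>, \<eta>)))\<^sup>2 / (2 * w) = D\<^sup>2 * (S * (S / (2 * w)))"
    using w by (simp add: fourier_integral_diagonal_strip D_def S_def norm_mult power2_eq_square)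
  have nn: "D \<ge> 0" "S \<ge> 0" by (auto simp: D_def S_def)
  have D: "D \<le> 1" "D \<le> 1 / (\<xi> + \<eta>)"
    using cmod_fourier_integral_interval_le_length[of 0 1 "\<xi> + \<eta>"]
      cmod_fourier_integral_interval_le_inverse[of 0 1 "\<xi> + \<eta>"] pos by (auto simp: D_def)
  have S: "S \<le> 2 * w" "S \<le> 1 / \<eta>"
    using cmod_fourier_integral_interval_le_length[of "-w" w \<eta>]
      cmod_fourier_integral_interval_le_inverse[of "-w" w \<eta>] pos w by (auto simp: S_def)
  have le: "D\<^sup>2 * (S * (S / (2 * w))) \<le> D\<^sup>2 * S"
    using nn S(1) w by (intro mult_left_mono mult_right_le_one_le) auto
  \<comment> \<open>A smooth substitute for the minimum of 1 and \<open>1 / t\<close>. Its use on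
    \<open>D\<close>, squared, and on \<open>S\<close> accounts for the constant 8 in
    \<open>quadrant_majorant\<close>; for \<open>S\<close> the bound by 1 comes from
    \<open>2 * w \<le> 1\<close>.\<close>
  have bound: "a \<le> 2 / (1 + t)" if "a \<le> 1" "a \<le> 1 / t" "t > 0" for a t :: real
  proof (cases "t \<le> 1")
    case True
    then have "1 \<le> 2 / (1 + t)" using that by simp
    with that show ?thesis by linarith
  next
    case False
    then have "1 / t \<le> 2 / (1 + t)" by (simp add: field_simps)
    with that show ?thesis by linarith
  qed
  have "D\<^sup>2 * S \<le> (2 / (1 + (\<xi> + \<eta>)))\<^sup>2 * (2 / (1 + \<eta>))"
    using nn pos D S w by (intro mult_mono power_mono bound) auto
  also have "\<dots> = quadrant_majorant (\<xi>, \<eta>)"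
    using pos by (simp add: quadrant_majorant_def power_divide add.assoc)
  finally show "(cmod (fourier_integral (indicator (diagonal_strip w)) (\<xi>, \<eta>)))\<^sup>2 / (2 * w) \<le> quadrant_majorant (\<xi>, \<eta>)"
    using le by (simp add: eq)
  have "D\<^sup>2 * S \<le> 1 * S"
    using nn D(1) by (intro mult_right_mono) (auto simp: power_le_one)
  then show "(cmod (fourier_integral (indicator (diagonal_strip w)) (\<xi>, \<eta>)))\<^sup>2 / (2 * w) \<le> 2 * w"
    using le S(1) by (simp add: eq)
qed

section \<open>The projected indicator and the contradiction\<close>

lemma L2_norm_P1_P2_indicator:
  assumes V: "open V" "emeasure lborel V < \<infinity>"
  shows "(L2_norm (P1_plus (P2_plus (indicator V))))\<^sup>2
    = (LINT \<xi>|lborel. (cmod (indicator {\<xi>. fst \<xi> > 0} \<xi> * (indicator {\<xi>. snd \<xi> > 0} \<xi> * fourier_integral (indicator V) \<xi>)))\<^sup>2)"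
proof -
  have [measurable]: "{\<xi> :: real \<times> real. fst \<xi> > 0} \<in> sets borel" "{\<xi> :: real \<times> real. snd \<xi> > 0} \<in> sets borel"
    by (auto intro!: borel_open open_Collect_less continuous_intros)
  have "has_L2_fourier (indicator V) (fourier_integral (indicator V))"
    using V by (intro has_L2_fourier_fourier_integral integrable_indicator_lborel L2_space_indicator) auto
  then have "has_L2_fourier (P1_plus (P2_plus (indicator V)))
      (\<lambda>\<xi>. indicator {\<xi>. fst \<xi> > 0} \<xi> * (indicator {\<xi>. snd \<xi> > 0} \<xi> * fourier_integral (indicator V) \<xi>))"
    unfolding P1_plus_def P2_plus_def by (intro has_L2_fourier_fourier_projection) auto
  from has_L2_fourier_norm[OF this] show ?thesis
    by (simp only: L2_norm_power2)
qed

theorem corollary1p1: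
  "\<not> (\<exists>c::real. c > 0 \<and>
        (\<forall>V :: (real \<times> real) set. open V \<and> emeasure lborel V < \<infinity> \<longrightarrow>
           L2_norm (P1_plus (P2_plus (indicator V))) \<ge> c * L2_norm (indicator V)))"
proof
  assume "\<exists>c::real. c > 0 \<and>
        (\<forall>V :: (real \<times> real) set. open V \<and> emeasure lborel V < \<infinity> \<longrightarrow>
           L2_norm (P1_plus (P2_plus (indicator V))) \<ge> c * L2_norm (indicator V))"
  then obtain c :: real where c: "c > 0"
    and le: "\<And>V. open V \<Longrightarrow> emeasure lborel V < \<infinity> \<Longrightarrow>
      c * L2_norm (indicator V :: real \<times> real \<Rightarrow> complex) \<le> L2_norm (P1_plus (P2_plus (indicator V)))"
    by blast
  \<comment> \<open>Chosen so that the area \<open>2 * w n = 1 / Suc n\<close> never exceeds 1, as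
    the majorant demands, and tends to 0.\<close>
  define w :: "nat \<Rightarrow> real" where "w n = 1 / Suc n / 2" for n
  have w: "w n > 0" "2 * w n \<le> 1" for n
    by (auto simp: w_def)
  have "2 * w n = inverse (real (Suc n))" for n
    by (simp add: w_def field_simps)
  then have w0: "(\<lambda>n. 2 * w n) \<longlonglongrightarrow> 0"
    using LIMSEQ_inverse_real_of_nat by (simp only:)
  have fin: "emeasure lborel (diagonal_strip (w n)) < \<infinity>" for n
    using emeasure_diagonal_strip[OF w(1)] by simp
  have [measurable]: "diagonal_strip (w n) \<in> sets borel" for n
    using open_diagonal_strip by (rule borel_open)
  have [measurable]: "(indicator (diagonal_strip (w n)) :: _ \<Rightarrow> complex) \<in> borel_measurable borel" for n
    by (rule borel_measurable_indicator) simp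
  have [measurable]: "{\<xi> :: real \<times> real. fst \<xi> > 0} \<in> sets borel" "{\<xi> :: real \<times> real. snd \<xi> > 0} \<in> sets borel"
    by (auto intro!: borel_open open_Collect_less continuous_intros)
  \<comment> \<open>The spectral density of the projected indicator divided by the area of the
    strip; its integral is the squared ratio of the two norms, which the assumed inequality keeps
    above \<open>c\<^sup>2\<close>.\<close>
  define T :: "nat \<Rightarrow> real \<times> real \<Rightarrow> real" where
    "T n \<xi> = (cmod (indicator {\<xi>. fst \<xi> > 0} \<xi> * (indicator {\<xi>. snd \<xi> > 0} \<xi>
      * fourier_integral (indicator (diagonal_strip (w n))) \<xi>)))\<^sup>2 / (2 * w n)" for n \<xi>
  \<comment> \<open>Off the open quadrant \<open>T n\<close> vanishes and the bounds are trivial;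
    inside it they are the two parts of \<open>cmod_fourier_strip_le\<close>.\<close>
  have T: "0 \<le> T n \<xi>" "T n \<xi> \<le> quadrant_majorant \<xi>" "T n \<xi> \<le> 2 * w n" for n \<xi>
    using cmod_fourier_strip_le[OF w, of "fst \<xi>" "snd \<xi>" n] w(1)[of n]
    by (auto simp: T_def indicator_def quadrant_majorant_def)
  have "(\<lambda>n. LINT \<xi>|lborel. T n \<xi>) \<longlonglongrightarrow> (LINT \<xi>::real \<times> real|lborel. 0)"
  proof (rule integral_dominated_convergence[OF _ _ integrable_quadrant_majorant])
    show "AE \<xi> in lborel. (\<lambda>n. T n \<xi>) \<longlonglongrightarrow> 0"
      using T by (intro AE_I2 tendsto_sandwich[OF _ _ tendsto_const w0]) auto
    show "T n \<in> borel_measurable lborel" for n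
      unfolding T_def by measurable
  qed (use T in auto)
  moreover have "c\<^sup>2 \<le> (LINT \<xi>|lborel. T n \<xi>)" for n
  proof -
    \<comment> \<open>The squared norm of the indicator is the area \<open>2 * w n\<close>.\<close>
    have "c\<^sup>2 * (2 * w n) = (c * L2_norm (indicator (diagonal_strip (w n)) :: real \<times> real \<Rightarrow> complex))\<^sup>2"
      using emeasure_diagonal_strip[OF w(1)[of n]] w(1)[of n]
      by (simp add: power_mult_distrib L2_norm_indicator_power2 measure_def)
    also have "\<dots> \<le> (L2_norm (P1_plus (P2_plus (indicator (diagonal_strip (w n))))))\<^sup>2"
      using c by (intro power_mono le open_diagonal_strip fin) auto
    also have "\<dots> = (LINT \<xi>|lborel. T n \<xi>) * (2 * w n)"
      using w(1)[of n] unfolding L2_norm_P1_P2_indicator[OF open_diagonal_strip fin] T_def by simp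
    finally show ?thesis
      using w(1)[of n] by simp
  qed
  ultimately have "c\<^sup>2 \<le> 0"
    by (intro tendsto_lowerbound[of "\<lambda>n. LINT \<xi>|lborel. T n \<xi>"]) auto
  with c show False by simp
qed

end
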